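(* Let $\Gamma$ be a finitely generated residually finite group which satisfies a non-trivial group law. Then $$\inf\left\{\frac{d(\Delta^{ab})-1}{|\Gamma:\Delta|}\ \middle|\ \Delta \text{ a subgroup of finite index in } \Gamma\right\}=0,$$ where the infimum is taken over all subgroups $\Delta$ of finite index in $\Gamma$.
   Context: $d(\cdot)$ is the minimal number of generators of a group, and $\Delta^{ab}=\Delta/[\Delta,\Delta]$ is the abelianization of $\Delta$. A group $\Gamma$ satisfies a non-trivial group law if there are $k\ge 1$ and a nontrivial element $w(x_1,\dots,x_k)$ of the free group on $x_1,\dots,x_k$ such that $w(g_1,\dots,g_k)=1$ for all $g_1,\dots,g_k\in \Gamma$.
   Formalization: The equality fails if a finite-index Δ is perfect (e.g. Γ finite, Δ=1: d=0, negative term). Proved instead: the infimum of max(0, (d(Δ^ab)-1)/|Γ:Δ|) is 0 for all such Γ, and the stated equality holds whenever no finite-index Δ is perfect. *)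

theory Defs
  imports Complex_Main "HOL-Algebra.Algebra"
begin

definition finitely_generated :: "('a, 'b) monoid_scheme \<Rightarrow> bool" where
  "finitely_generated G \<longleftrightarrow>
     (\<exists>S. finite S \<and> S \<subseteq> carrier G \<and> generate G S = carrier G)"

text \<open>The trivial group is generated by the empty set, so its value is 0. The value is only
  meaningful for finitely generated groups.\<close>

definition min_generators :: "('a, 'b) monoid_scheme \<Rightarrow> nat" where
  "min_generators G =
     (LEAST n. \<exists>S. finite S \<and> card S = n \<and> S \<subseteq> carrier G \<and> generate G S = carrier G)"

definition abelianization :: "('a, 'b) monoid_scheme \<Rightarrow> 'a set monoid" where
  "abelianization G = G Mod derived G (carrier G)"

definition subgroup_index :: "('a, 'b) monoid_scheme \<Rightarrow> 'a set \<Rightarrow> nat" where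
  "subgroup_index G H = card (rcosets\<^bsub>G\<^esub> H)"

definition finite_index_subgroup :: "'a set \<Rightarrow> ('a, 'b) monoid_scheme \<Rightarrow> bool" where
  "finite_index_subgroup H G \<longleftrightarrow> subgroup H G \<and> finite (rcosets\<^bsub>G\<^esub> H)"

definition residually_finite :: "('a, 'b) monoid_scheme \<Rightarrow> bool" where
  "residually_finite G \<longleftrightarrow>
     (\<forall>g \<in> carrier G - {\<one>\<^bsub>G\<^esub>}. \<exists>N. N \<lhd> G \<and> finite (rcosets\<^bsub>G\<^esub> N) \<and> g \<notin> N)"

text \<open>Elements of the free group on letters \<open>0, \<dots>, k - 1\<close> are represented by their unique
  reduced words, so the nontrivial elements are exactly the nonempty reduced words. The letter
  \<open>(i, False)\<close> stands for the \<open>i\<close>-th generator and \<open>(i, True)\<close> for its inverse.\<close>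

type_synonym group_word = "(nat \<times> bool) list"

definition reduced_word :: "group_word \<Rightarrow> bool" where
  "reduced_word w \<longleftrightarrow>
     (\<forall>j. Suc j < length w \<longrightarrow> \<not> (fst (w ! j) = fst (w ! Suc j) \<and> snd (w ! j) \<noteq> snd (w ! Suc j)))"

definition free_group_elements :: "nat \<Rightarrow> group_word set" where
  "free_group_elements k = {w. fst ` set w \<subseteq> {..<k} \<and> reduced_word w}"

fun word_value :: "('a, 'b) monoid_scheme \<Rightarrow> (nat \<Rightarrow> 'a) \<Rightarrow> group_word \<Rightarrow> 'a" where
  "word_value G g [] = \<one>\<^bsub>G\<^esub>"
| "word_value G g ((i, e) # w) =
     (if e then inv\<^bsub>G\<^esub> (g i) else g i) \<otimes>\<^bsub>G\<^esub> word_value G g w"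

definition satisfies_group_law :: "('a, 'b) monoid_scheme \<Rightarrow> bool" where
  "satisfies_group_law G \<longleftrightarrow>
     (\<exists>k \<ge> 1. \<exists>w \<in> free_group_elements k. w \<noteq> [] \<and>
        (\<forall>g. (\<forall>i<k. g i \<in> carrier G) \<longrightarrow> word_value G g w = \<one>\<^bsub>G\<^esub>))"

text \<open>The quantity \<open>(d(\<Delta>\<^sup>a\<^sup>b) - 1) / |\<Gamma> : \<Delta>|\<close>. It equals \<open>- 1 / |\<Gamma> : \<Delta>|\<close>, hence is negative,
  when \<open>\<Delta>\<close> is perfect. This occurs for every finite \<open>\<Gamma>\<close> (take \<open>\<Delta>\<close> trivial), but also for
  some infinite \<open>\<Gamma>\<close>. For instance, the semidirect product of the root lattice \<open>A\<^sub>4\<close> by the alternating group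
  of degree 5 is perfect, residually finite, and satisfies the law \<open>[x\<^sup>6\<^sup>0, y\<^sup>6\<^sup>0]\<close>.\<close>

definition ab_gradient_term :: "('a, 'b) monoid_scheme \<Rightarrow> 'a set \<Rightarrow> real" where
  "ab_gradient_term G D =
     (real (min_generators (abelianization (G\<lparr>carrier := D\<rparr>))) - 1) / real (subgroup_index G D)"

end

theory Submission
  imports Defs
begin

text \<open>
  Since \<open>d(\<Delta>\<^sup>a\<^sup>b) \<le> d(\<Delta>)\<close>, it is enough to find, for every \<open>\<epsilon> > 0\<close>, a subgroup \<open>\<Delta>\<close> of finite index
  with \<open>d(\<Delta>) \<le> \<epsilon> |\<Gamma> : \<Delta>|\<close>. The idea is that a group law expresses most Schreier generators of a
  suitable \<open>\<Delta>\<close> through the remaining ones.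

  One relation. Suppose that a word \<open>v\<close> takes the same value on all tuples of a coset \<open>\<Delta>\<^sub>1 y\<^sub>1 \<times> \<Delta>\<^sub>1 y\<^sub>2 \<times> \<dots>\<close>.
  Multiplying the entry \<open>g\<^sub>i\<close> of such a tuple by \<open>a \<in> \<Delta>\<^sub>1\<close> does not change the value of \<open>v\<close>, and
  collecting the changes gives \<open>\<Prod> t\<^sub>j a\<^sup>\<plusminus>\<^sup>1 t\<^sub>j\<inverse> = 1\<close>, the product running over the occurrences \<open>j\<close>
  of the letter \<open>i\<close>, where \<open>t\<^sub>j\<close> is the value of a prefix of \<open>v\<close>. This is Fox calculus, written multiplicatively.
  Hence, with \<open>s\<^sub>j = t\<^sub>0\<inverse> t\<^sub>j\<close> for a fixed occurrence \<open>0\<close>, the element \<open>a\<close> lies in the subgroup generated by the conjugates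
  \<open>s\<^sub>j a s\<^sub>j\<inverse>\<close>, \<open>j \<noteq> 0\<close> (lemma \<open>word_value_perturb_solve\<close>).

  Many independent relations. Take \<open>v\<close> shortest among the nonempty reduced words that are constant
  on some coset of this kind; the law itself is such a word. If the
  occurrence \<open>0\<close> is well chosen, the \<open>s\<^sub>j\<close> are values of shorter nonempty words or inverses of such values, and
  these words are constant on no coset. Residual finiteness therefore allows a choice of \<open>N\<close> tuples in the coset
  whose sets \<open>{s\<^sub>j}\<close> are pairwise disjoint (lemma \<open>tuples_with_disjoint_offsets\<close>), even modulo a deep
  normal subgroup \<open>\<Delta>\<close> of finite index.

  Saving generators. Let \<open>Q = \<Gamma> / \<Delta>\<close>. Up to correction terms, which are at most \<open>N |v|\<close> for each
  element of \<open>Q\<close>, conjugation by \<open>s\<close> moves the Schreier generator at \<open>y \<in> Q\<close> to the one at \<open>s y\<close>. So the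
  generators at \<open>y\<close> are superfluous as soon as, for one of the \<open>N\<close> tuples, all generators at the
  points \<open>s\<^sub>j y\<close> are present. For a random subset \<open>S\<close> of \<open>Q\<close> of density \<open>q\<close>, the \<open>N\<close> blocks
  \<open>{s\<^sub>j y}\<close> of a given \<open>y\<close> are disjoint, so all of them fail with probability at most
  \<open>(1 - q\<^sup>\<ell>)\<^sup>N\<close>, where \<open>\<ell>\<close> is the length of the law. Hence
  \<open>d(\<Delta>) \<le> (d(\<Gamma>) (q + (1 - q\<^sup>\<ell>)\<^sup>N) + N \<ell>) |\<Gamma> : \<Delta>|\<close>
  (lemma \<open>finite_index_subgroup_few_generators\<close>).

  Diluting the corrections. The term \<open>N \<ell>\<close> does not grow with the number of generators, and subgroups
  of \<open>\<Gamma>\<close> satisfy the same law. If \<open>\<Gamma>\<close> is infinite, the last bound is applied to a subgroup of large index \<open>m\<close>, which has at most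
  \<open>d(\<Gamma>) m\<close> generators; after division by \<open>m\<close> the term becomes \<open>N \<ell> / m\<close>. First \<open>q\<close>, then \<open>N\<close> and finally \<open>m\<close> are
  chosen according to \<open>\<epsilon>\<close>. If \<open>\<Gamma>\<close> is finite, the trivial subgroup has a negative term.

  If no subgroup of finite index is perfect, all the abelianizations are nontrivial and all terms are
  nonnegative, so the truncation at 0 changes nothing.
\<close>

section \<open>Averages over random subsets\<close>

text \<open>The expectation of \<open>F S\<close> for a random subset \<open>S\<close> of \<open>V\<close> that contains each element independently
  with probability \<open>q\<close>.\<close>
definition subset_mean :: "real \<Rightarrow> 'a set \<Rightarrow> ('a set \<Rightarrow> real) \<Rightarrow> real" where
  "subset_mean q V F = (\<Sum>S\<in>Pow V. q ^ card S * (1 - q) ^ card (V - S) * F S)"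

lemma subset_mean_cong:
  "(\<And>S. S \<subseteq> V \<Longrightarrow> F S = F' S) \<Longrightarrow> subset_mean q V F = subset_mean q V F'"
  unfolding subset_mean_def by (intro sum.cong) auto

lemma subset_mean_add:
  "subset_mean q V (\<lambda>S. F S + F' S) = subset_mean q V F + subset_mean q V F'"
  unfolding subset_mean_def by (simp add: sum.distrib algebra_simps)

lemma subset_mean_diff:
  "subset_mean q V (\<lambda>S. F S - F' S) = subset_mean q V F - subset_mean q V F'"
  unfolding subset_mean_def by (simp add: sum_subtractf algebra_simps)

lemma subset_mean_cmult:
  "subset_mean q V (\<lambda>S. c * F S) = c * subset_mean q V F"
  unfolding subset_mean_def by (simp add: sum_distrib_left algebra_simps)

lemma subset_mean_sum:
  "subset_mean q V (\<lambda>S. \<Sum>i\<in>I. F i S) = (\<Sum>i\<in>I. subset_mean q V (F i))"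
  unfolding subset_mean_def sum_distrib_left by (rule sum.swap)

lemma subset_mean_insert:
  assumes "finite V" "x \<notin> V"
  shows "subset_mean q (insert x V) F
           = (1 - q) * subset_mean q V F + q * subset_mean q V (\<lambda>S. F (insert x S))"
proof -
  have fin: "finite S" if "S \<subseteq> V" for S
    using that assms(1) finite_subset by blast
  have out: "card (insert x V - S) = Suc (card (V - S))" if "S \<subseteq> V" for S
  proof -
    have "insert x V - S = insert x (V - S)" using that assms by auto
    then show ?thesis using assms by simp
  qed
  have "inj_on (insert x) (Pow V)"
    using assms(2) by (intro inj_onI) (metis PowD insert_ident subsetD)
  moreover have "Pow V \<inter> insert x ` Pow V = {}" using assms(2) by auto
  moreover have "insert x V - insert x S = V - S" for S using assms(2) by auto
  moreover have "card (insert x S) = Suc (card S)" if "S \<subseteq> V" for S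
    using that assms(2) fin by (intro card_insert_disjoint) auto
  ultimately show ?thesis
    unfolding subset_mean_def Pow_insert using assms(1)
    by (simp add: sum.union_disjoint sum.reindex sum_distrib_left out algebra_simps)
qed

lemma subset_mean_Un:
  assumes "finite A" "finite B" "A \<inter> B = {}"
  shows "subset_mean q (A \<union> B) F = subset_mean q A (\<lambda>S. subset_mean q B (\<lambda>T. F (S \<union> T)))"
  using assms(2,3)
proof (induction B arbitrary: F rule: finite_induct)
  case empty
  then show ?case by (simp add: subset_mean_def)
next
  case (insert x B)
  have "subset_mean q (A \<union> insert x B) F
      = (1 - q) * subset_mean q (A \<union> B) F + q * subset_mean q (A \<union> B) (\<lambda>S. F (insert x S))"
    using insert assms(1) subset_mean_insert[of "A \<union> B" x q F] by simp
  then show ?case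
    using insert
    by (simp add: subset_mean_insert subset_mean_add subset_mean_cmult)
qed

lemma subset_mean_const: "finite V \<Longrightarrow> subset_mean q V (\<lambda>_. c) = c"
  by (induction V rule: finite_induct)
    (simp_all add: subset_mean_insert algebra_simps, simp add: subset_mean_def)

lemma subset_mean_card: "finite V \<Longrightarrow> subset_mean q V (\<lambda>S. real (card S)) = q * real (card V)"
proof (induction V rule: finite_induct)
  case empty
  then show ?case by (simp add: subset_mean_def)
next
  case (insert x V)
  have "subset_mean q V (\<lambda>S. real (card (insert x S))) = subset_mean q V (\<lambda>S. real (card S) + 1)"
    using insert by (intro subset_mean_cong) (auto simp: finite_subset card_insert_if)
  then show ?case
    using insert by (simp add: subset_mean_insert subset_mean_add subset_mean_const algebra_simps)
qed

lemma subset_mean_proper: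
  assumes "finite B"
  shows "subset_mean q B (\<lambda>T. of_bool (T \<noteq> B)) = 1 - q ^ card B"
proof -
  have "subset_mean q B (\<lambda>T. of_bool (T = B)) = (\<Sum>S\<in>{B}. q ^ card S * (1 - q) ^ card (B - S))"
    unfolding subset_mean_def using assms
    by (intro sum.mono_neutral_cong_right) auto
  moreover have "subset_mean q B (\<lambda>T. of_bool (T \<noteq> B)) = subset_mean q B (\<lambda>T. 1 - of_bool (T = B))"
    by (intro subset_mean_cong) simp
  ultimately show ?thesis using assms by (simp add: subset_mean_diff subset_mean_const)
qed

text \<open>Independence: events that depend on disjoint parts of a random subset have probabilities
  that multiply.\<close>
lemma subset_mean_no_block:
  fixes B :: "nat \<Rightarrow> 'a set"
  assumes "finite V" "\<And>l. l < N \<Longrightarrow> B l \<subseteq> V" "disjoint_family_on B {..<N}"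
  shows "subset_mean q V (\<lambda>S. of_bool (\<forall>l<N. \<not> B l \<subseteq> S)) = (\<Prod>l<N. 1 - q ^ card (B l))"
  using assms
proof (induction N arbitrary: V)
  case 0
  then show ?case by (simp add: subset_mean_const)
next
  case (Suc N)
  let ?Y = "V - B N"
  have finB: "finite (B N)" using Suc.prems(1,2) finite_subset by blast
  have sub: "B l \<subseteq> ?Y" if "l < N" for l
    using Suc.prems(2)[of l] that disjoint_family_onD[OF Suc.prems(3), of l N] by auto
  have split: "of_bool (\<forall>l<Suc N. \<not> B l \<subseteq> S \<union> T)
      = of_bool (\<forall>l<N. \<not> B l \<subseteq> S) * (of_bool (T \<noteq> B N) :: real)"
    if "S \<subseteq> ?Y" "T \<subseteq> B N" for S T
  proof -
    have "B l \<subseteq> S \<union> T \<longleftrightarrow> B l \<subseteq> S" if "l < N" for l using sub[OF that] \<open>T \<subseteq> B N\<close> by blast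
    moreover have "B N \<subseteq> S \<union> T \<longleftrightarrow> T = B N" using \<open>S \<subseteq> ?Y\<close> \<open>T \<subseteq> B N\<close> by blast
    ultimately show ?thesis by (auto simp: less_Suc_eq)
  qed
  have "V = ?Y \<union> B N" using Suc.prems(2)[of N] by auto
  then have "subset_mean q V (\<lambda>S. of_bool (\<forall>l<Suc N. \<not> B l \<subseteq> S))
      = subset_mean q ?Y (\<lambda>S. subset_mean q (B N) (\<lambda>T. of_bool (\<forall>l<Suc N. \<not> B l \<subseteq> S \<union> T)))"
    using subset_mean_Un[of ?Y "B N" q "\<lambda>S. of_bool (\<forall>l<Suc N. \<not> B l \<subseteq> S)"] Suc.prems(1) finB
    by (metis Diff_disjoint finite_Diff inf_commute)
  also have "\<dots> = subset_mean q ?Y (\<lambda>S. (1 - q ^ card (B N)) * of_bool (\<forall>l<N. \<not> B l \<subseteq> S))"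
  proof (rule subset_mean_cong)
    fix S assume "S \<subseteq> ?Y"
    then have "subset_mean q (B N) (\<lambda>T. of_bool (\<forall>l<Suc N. \<not> B l \<subseteq> S \<union> T))
        = subset_mean q (B N) (\<lambda>T. of_bool (\<forall>l<N. \<not> B l \<subseteq> S) * of_bool (T \<noteq> B N))"
      by (intro subset_mean_cong split)
    also have "\<dots> = (1 - q ^ card (B N)) * of_bool (\<forall>l<N. \<not> B l \<subseteq> S)"
      unfolding subset_mean_cmult subset_mean_proper[OF finB] by (rule mult.commute)
    finally show "subset_mean q (B N) (\<lambda>T. of_bool (\<forall>l<Suc N. \<not> B l \<subseteq> S \<union> T))
        = (1 - q ^ card (B N)) * of_bool (\<forall>l<N. \<not> B l \<subseteq> S)" .
  qed
  also have "\<dots> = (1 - q ^ card (B N)) * (\<Prod>l<N. 1 - q ^ card (B l))"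
  proof -
    have "disjoint_family_on B {..<N}"
      using Suc.prems(3) by (rule disjoint_family_on_mono[rotated]) auto
    then have "subset_mean q ?Y (\<lambda>S. of_bool (\<forall>l<N. \<not> B l \<subseteq> S)) = (\<Prod>l<N. 1 - q ^ card (B l))"
      by (intro Suc.IH finite_Diff Suc.prems(1) sub)
    then show ?thesis
      by (simp only: subset_mean_cmult)
  qed
  finally show ?case
    unfolding prod.lessThan_Suc by (simp only: mult.commute)
qed

lemma exists_le_subset_mean:
  assumes "finite V" "0 < q" "q < 1"
  obtains S where "S \<subseteq> V" "F S \<le> subset_mean q V F"
proof (rule ccontr)
  assume neg: "\<not> thesis"
  let ?m = "subset_mean q V F"
  have "subset_mean q V (\<lambda>_. ?m) < ?m"
  proof (subst (3) subset_mean_def, subst subset_mean_def, rule sum_strict_mono)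
    fix S assume "S \<in> Pow V"
    then have "?m < F S" using that[of S] neg by (meson PowD not_le_imp_less)
    then show "q ^ card S * (1 - q) ^ card (V - S) * ?m < q ^ card S * (1 - q) ^ card (V - S) * F S"
      using assms by (intro mult_strict_left_mono) auto
  qed (use assms in auto)
  then show False using assms(1) by (simp add: subset_mean_const)
qed

text \<open>Each point \<open>x\<close> carries \<open>N\<close> disjoint blocks of size at most \<open>b\<close>. The set \<open>S\<close> is found by averaging:
  a random subset of density \<open>q\<close> has \<open>q |V|\<close> elements in the mean, and independence of the
  blocks bounds by \<open>(1 - q\<^sup>b)\<^sup>N\<close> the probability that none of the blocks of \<open>x\<close> lies in it.
  For fixed \<open>b\<close> the bound is a small multiple of \<open>|V|\<close>: choose \<open>q\<close> small, then \<open>N\<close> large.\<close>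
lemma exists_small_spanning_subset:
  fixes B :: "nat \<Rightarrow> 'a \<Rightarrow> 'a set"
  assumes "finite V" "0 < q" "q < 1"
    and "\<And>l x. l < N \<Longrightarrow> x \<in> V \<Longrightarrow> B l x \<subseteq> V \<and> card (B l x) \<le> b"
    and "\<And>x. x \<in> V \<Longrightarrow> disjoint_family_on (\<lambda>l. B l x) {..<N}"
  obtains S where "S \<subseteq> V"
    "real (card S + card {x \<in> V. \<forall>l<N. \<not> B l x \<subseteq> S}) \<le> (q + (1 - q ^ b) ^ N) * real (card V)"
proof -
  define F where "F S = real (card S) + (\<Sum>x\<in>V. of_bool (\<forall>l<N. \<not> B l x \<subseteq> S))" for S
  have "subset_mean q V F = q * real (card V) + (\<Sum>x\<in>V. \<Prod>l<N. 1 - q ^ card (B l x))"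
    unfolding F_def subset_mean_add subset_mean_card[OF assms(1)] subset_mean_sum
    by (intro arg_cong2[of _ _ _ _ "(+)"] refl sum.cong subset_mean_no_block)
      (use assms in auto)
  also have "(\<Sum>x\<in>V. \<Prod>l<N. 1 - q ^ card (B l x)) \<le> (\<Sum>x\<in>V. \<Prod>l<N. 1 - q ^ b)"
    using assms(2-4) by (intro sum_mono prod_mono) (auto intro: power_le_one power_decreasing)
  finally have mean: "subset_mean q V F \<le> (q + (1 - q ^ b) ^ N) * real (card V)"
    by (simp add: algebra_simps)
  obtain S where S: "S \<subseteq> V" "F S \<le> subset_mean q V F"
    using exists_le_subset_mean[OF assms(1-3)] .
  have "(\<Sum>x\<in>V. of_bool (\<forall>l<N. \<not> B l x \<subseteq> S)) = real (card {x \<in> V. \<forall>l<N. \<not> B l x \<subseteq> S})"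
    using assms(1) by (simp add: of_bool_def sum.If_cases Int_def)
  with S mean show ?thesis by (intro that[of S]) (auto simp: F_def)
qed

section \<open>Perturbing one letter of a word\<close>

lemma (in group) mult_inv_cancel_left:
  assumes "x \<in> carrier G" "y \<in> carrier G"
  shows "x \<otimes> (inv x \<otimes> y) = y" "inv x \<otimes> (x \<otimes> y) = y"
  using assms by (simp_all flip: m_assoc)

lemmas (in group) group_word_simps = m_assoc inv_mult_group mult_inv_cancel_left

lemma (in group) word_value_closed [simp, intro]:
  "(\<And>i. g i \<in> carrier G) \<Longrightarrow> word_value G g w \<in> carrier G"
  by (induction w) auto

lemma (in group) word_value_append:
  "(\<And>i. g i \<in> carrier G) \<Longrightarrow>
    word_value G g (u @ v) = word_value G g u \<otimes> word_value G g v"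
  by (induction u) (auto simp: m_assoc)

text \<open>Evaluation of words commutes with passage to \<open>G / N\<close>.\<close>
lemma (in group) word_value_normal_cong:
  assumes "N \<lhd> G" "\<And>i. g i \<in> carrier G" "\<And>i. g' i \<in> carrier G"
    and "\<And>i. g' i \<otimes> inv (g i) \<in> N"
  shows "word_value G g' w \<otimes> inv (word_value G g w) \<in> N"
proof (induction w)
  case Nil
  then show ?case
    using assms(1) by (simp add: normal_imp_subgroup subgroup.one_closed)
next
  case (Cons l w)
  obtain i e where l: "l = (i, e)" by force
  let ?l = "if e then inv (g i) else g i" and ?l' = "if e then inv (g' i) else g' i"
  let ?v = "word_value G g w" and ?v' = "word_value G g' w"
  note sub = normal_imp_subgroup[OF assms(1)]
  have closed: "?l \<in> carrier G" "?l' \<in> carrier G" "?v \<in> carrier G" "?v' \<in> carrier G"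
    using assms(2,3) by auto
  have "?l' \<otimes> inv ?l \<in> N"
  proof (cases e)
    case True
    have "inv (g' i) \<otimes> inv (g' i \<otimes> inv (g i)) \<otimes> g' i \<in> N"
      using assms by (simp add: normal.inv_op_closed1 subgroup.m_inv_closed[OF sub])
    then show ?thesis
      using True assms(2,3) by (simp add: group_word_simps)
  qed (use assms(4) in simp)
  moreover have "?l' \<otimes> (?v' \<otimes> inv ?v) \<otimes> inv ?l' \<in> N"
    using normal.inv_op_closed2[OF assms(1) closed(2) Cons.IH] .
  ultimately have "?l' \<otimes> (?v' \<otimes> inv ?v) \<otimes> inv ?l' \<otimes> (?l' \<otimes> inv ?l) \<in> N"
    using subgroup.m_closed[OF sub] by blast
  also have "?l' \<otimes> (?v' \<otimes> inv ?v) \<otimes> inv ?l' \<otimes> (?l' \<otimes> inv ?l) = ?l' \<otimes> ?v' \<otimes> inv (?l \<otimes> ?v)"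
    using closed by (simp only: group_word_simps inv_closed m_closed)
  finally show ?case by (simp only: l word_value.simps)
qed

text \<open>The change at an occurrence \<open>x\<inverse>\<close> is \<open>x\<inverse> a\<inverse>\<close> instead of \<open>x\<inverse>\<close>, so \<open>a\<close> is
  conjugated by a prefix that includes this letter; at an occurrence \<open>x\<close> the letter is excluded.\<close>
definition prefix_len :: "group_word \<Rightarrow> nat \<Rightarrow> nat" where
  "prefix_len w j = (if snd (w ! j) then Suc j else j)"

definition prefix_value :: "('a, 'b) monoid_scheme \<Rightarrow> (nat \<Rightarrow> 'a) \<Rightarrow> group_word \<Rightarrow> nat \<Rightarrow> 'a" where
  "prefix_value G g w j = word_value G g (take (prefix_len w j) w)"

lemma (in group) prefix_value_closed [simp, intro]:
  "(\<And>i. g i \<in> carrier G) \<Longrightarrow> prefix_value G g w j \<in> carrier G"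
  by (simp add: prefix_value_def)

lemma (in group) prefix_value_append:
  assumes "\<And>i. g i \<in> carrier G"
  shows "prefix_value G g (u @ v) (length u + j) = word_value G g u \<otimes> prefix_value G g v j"
proof -
  have "prefix_len (u @ v) (length u + j) = length u + prefix_len v j"
    by (simp add: prefix_len_def)
  then show ?thesis
    using assms by (simp add: prefix_value_def word_value_append)
qed

lemma prefix_value_take:
  assumes "j < n"
  shows "prefix_value G g (take n w) j = prefix_value G g w j"
  using assms by (simp add: prefix_value_def prefix_len_def min_def)

text \<open>The quotient of the new value by the old one is the product, in order, of the
  conjugates \<open>t\<^sub>j a\<^sup>\<plusminus>\<^sup>1 t\<^sub>j\<inverse>\<close> over the occurrences \<open>j\<close> of the letter \<open>i\<close>. The factor \<open>c\<close> is what the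
  induction on \<open>w\<close> accumulates from the letters already passed.\<close>
lemma (in group) word_value_perturb:
  assumes "subgroup H G" "\<And>k. g k \<in> carrier G" "a \<in> carrier G" "c \<in> carrier G"
    and "\<And>j. j < length w \<Longrightarrow> fst (w ! j) = i \<Longrightarrow>
      c \<otimes> prefix_value G g w j \<otimes> a \<otimes> inv (c \<otimes> prefix_value G g w j) \<in> H"
  shows "c \<otimes> word_value G (g(i := a \<otimes> g i)) w \<otimes> inv (c \<otimes> word_value G g w) \<in> H"
  using assms(4,5)
proof (induction w arbitrary: c)
  case Nil
  then show ?case using assms(1) by (simp add: subgroup.one_closed)
next
  case (Cons l w)
  obtain k e where l: "l = (k, e)" by force
  let ?g' = "g(i := a \<otimes> g i)"
  let ?l = "if e then inv (g k) else g k" and ?l' = "if e then inv (?g' k) else ?g' k"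
  let ?v = "word_value G g w" and ?v' = "word_value G ?g' w"
  have g': "?g' n \<in> carrier G" for n using assms(2,3) by simp
  have closed: "c \<in> carrier G" "?l \<in> carrier G" "?l' \<in> carrier G" "?v \<in> carrier G" "?v' \<in> carrier G"
    using assms(2) Cons.prems(1) g' by (auto simp del: fun_upd_apply)
  have first: "c \<otimes> ?l' \<otimes> inv (c \<otimes> ?l) \<in> H"
  proof (cases "k = i")
    case True
    have hyp: "c \<otimes> prefix_value G g (l # w) 0 \<otimes> a \<otimes> inv (c \<otimes> prefix_value G g (l # w) 0) \<in> H"
      using Cons.prems(2)[of 0] True l by simp
    show ?thesis
    proof (cases e)
      case e: True
      have "inv (c \<otimes> inv (g i) \<otimes> a \<otimes> inv (c \<otimes> inv (g i))) \<in> H"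
        using hyp True e l assms(2)
        by (intro subgroup.m_inv_closed[OF assms(1)]) (simp add: prefix_value_def prefix_len_def)
      then show ?thesis
        using True e closed(1) assms(2,3) by (simp add: group_word_simps)
    next
      case False
      then show ?thesis
        using hyp True l closed(1) assms(2,3)
        by (simp add: prefix_value_def prefix_len_def group_word_simps)
    qed
  next
    case False
    then show ?thesis
      using closed subgroup.one_closed[OF assms(1)] by (auto simp: group_word_simps)
  qed
  have pv: "c \<otimes> prefix_value G g (l # w) (Suc j) = c \<otimes> ?l \<otimes> prefix_value G g w j" for j
    using prefix_value_append[of g "[l]" w j] l assms(2) closed by (simp add: m_assoc)
  have "c \<otimes> ?l \<otimes> ?v' \<otimes> inv (c \<otimes> ?l \<otimes> ?v) \<in> H"
    by (rule Cons.IH) (use closed Cons.prems(2)[of "Suc _", simplified, unfolded pv] in auto)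
  then have "(c \<otimes> ?l' \<otimes> inv (c \<otimes> ?l)) \<otimes> (c \<otimes> ?l \<otimes> ?v' \<otimes> inv (c \<otimes> ?l \<otimes> ?v)) \<in> H"
    by (rule subgroup.m_closed[OF assms(1) first])
  also have "(c \<otimes> ?l' \<otimes> inv (c \<otimes> ?l)) \<otimes> (c \<otimes> ?l \<otimes> ?v' \<otimes> inv (c \<otimes> ?l \<otimes> ?v))
      = c \<otimes> (?l' \<otimes> ?v') \<otimes> inv (c \<otimes> (?l \<otimes> ?v))"
    using closed by (simp only: group_word_simps inv_closed m_closed)
  finally show ?case by (simp only: l word_value.simps)
qed

text \<open>If the perturbation does not change the value, the product of conjugates is trivial and can be
  solved for the factor of any single occurrence.\<close>
lemma (in group) word_value_perturb_solve:
  assumes "subgroup H G" "\<And>k. g k \<in> carrier G" "a \<in> carrier G" "c \<in> carrier G"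
    and j0: "j0 < length w" "fst (w ! j0) = i"
    and eq: "word_value G (g(i := a \<otimes> g i)) w = word_value G g w"
    and others: "\<And>j. j < length w \<Longrightarrow> j \<noteq> j0 \<Longrightarrow> fst (w ! j) = i \<Longrightarrow>
      c \<otimes> prefix_value G g w j \<otimes> a \<otimes> inv (c \<otimes> prefix_value G g w j) \<in> H"
  shows "c \<otimes> prefix_value G g w j0 \<otimes> a \<otimes> inv (c \<otimes> prefix_value G g w j0) \<in> H"
proof -
  define u where "u = take j0 w"
  define v where "v = drop (Suc j0) w"
  obtain e where e: "w ! j0 = (i, e)" using j0(2) by (metis prod.collapse)
  have w: "w = u @ [(i, e)] @ v"
    unfolding u_def v_def using j0(1) e by (simp flip: e add: Cons_nth_drop_Suc)
  have len_u: "length u = j0" using j0(1) by (simp add: u_def)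
  let ?g' = "g(i := a \<otimes> g i)"
  let ?l = "if e then inv (g i) else g i" and ?l' = "if e then inv (a \<otimes> g i) else a \<otimes> g i"
  let ?u = "word_value G g u" and ?u' = "word_value G ?g' u"
  let ?v = "word_value G g v" and ?v' = "word_value G ?g' v"
  let ?t = "prefix_value G g w j0"
  have g': "?g' k \<in> carrier G" for k using assms(2,3) by simp
  have closed: "c \<in> carrier G" "a \<in> carrier G" "g i \<in> carrier G" "?u \<in> carrier G" "?u' \<in> carrier G"
      "?v \<in> carrier G" "?v' \<in> carrier G" "?l \<in> carrier G" "?l' \<in> carrier G"
    using assms(2-4) g' by (auto simp del: fun_upd_apply)
  have t: "?t = (if e then ?u \<otimes> inv (g i) else ?u)"
    using prefix_value_append[of g u "[(i, e)] @ v" 0] assms(2) closed w len_u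
    by (simp add: prefix_value_def prefix_len_def)
  have left: "c \<otimes> ?u' \<otimes> inv (c \<otimes> ?u) \<in> H"
  proof (rule word_value_perturb[OF assms(1-4)])
    fix j assume "j < length u" "fst (u ! j) = i"
    then show "c \<otimes> prefix_value G g u j \<otimes> a \<otimes> inv (c \<otimes> prefix_value G g u j) \<in> H"
      using others[of j] j0(1) by (simp add: u_def prefix_value_take)
  qed
  have right: "c \<otimes> ?u \<otimes> ?l \<otimes> ?v' \<otimes> inv (c \<otimes> ?u \<otimes> ?l \<otimes> ?v) \<in> H"
  proof (rule word_value_perturb[OF assms(1-3)])
    fix j assume j: "j < length v" "fst (v ! j) = i"
    have "prefix_value G g w (length (u @ [(i, e)]) + j) = ?u \<otimes> ?l \<otimes> prefix_value G g v j"
      using prefix_value_append[of g "u @ [(i, e)]" v j] assms(2) w closed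
      by (simp add: word_value_append m_assoc)
    moreover have "c \<otimes> prefix_value G g w (length (u @ [(i, e)]) + j) \<otimes> a
        \<otimes> inv (c \<otimes> prefix_value G g w (length (u @ [(i, e)]) + j)) \<in> H"
      by (rule others) (use j len_u in \<open>auto simp: v_def\<close>)
    ultimately show "c \<otimes> ?u \<otimes> ?l \<otimes> prefix_value G g v j \<otimes> a
        \<otimes> inv (c \<otimes> ?u \<otimes> ?l \<otimes> prefix_value G g v j) \<in> H"
      using closed assms(2) by (simp add: m_assoc)
  qed (use closed in simp)
  have "?u' \<otimes> (?l' \<otimes> ?v') = ?u \<otimes> (?l \<otimes> ?v)"
    using eq closed assms(2) g' by (simp add: w word_value_append del: fun_upd_apply) (simp split: if_splits)
  then have v': "?v' = inv ?l' \<otimes> (inv ?u' \<otimes> (?u \<otimes> (?l \<otimes> ?v)))"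
    using closed mult_inv_cancel_left(2)[of ?u' "?l' \<otimes> ?v'"] mult_inv_cancel_left(2)[of ?l' ?v']
    by (simp only: m_closed)
  \<comment> \<open>In this order everything but a conjugate of the quotient of the old letter by the new one cancels.\<close>
  have "(c \<otimes> ?u \<otimes> ?l \<otimes> ?v' \<otimes> inv (c \<otimes> ?u \<otimes> ?l \<otimes> ?v)) \<otimes> (c \<otimes> ?u' \<otimes> inv (c \<otimes> ?u)) \<in> H"
    using subgroup.m_closed[OF assms(1) right left] .
  also have "(c \<otimes> ?u \<otimes> ?l \<otimes> ?v' \<otimes> inv (c \<otimes> ?u \<otimes> ?l \<otimes> ?v)) \<otimes> (c \<otimes> ?u' \<otimes> inv (c \<otimes> ?u))
      = c \<otimes> (?u \<otimes> (?l \<otimes> (inv ?l' \<otimes> (inv ?u \<otimes> inv c))))"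
    unfolding v' using closed
    by (simp only: group_word_simps inv_closed m_closed)
  finally have *: "c \<otimes> (?u \<otimes> (?l \<otimes> (inv ?l' \<otimes> (inv ?u \<otimes> inv c)))) \<in> H" .
  show ?thesis
  proof (cases e)
    case True
    then show ?thesis using * closed(1-4) by (simp add: t group_word_simps)
  next
    case False
    then show ?thesis
      using subgroup.m_inv_closed[OF assms(1) *] closed(1-4) by (simp add: t group_word_simps)
  qed
qed

lemma reduced_word_take: "reduced_word w \<Longrightarrow> reduced_word (take n w)"
  by (simp add: reduced_word_def)

lemma reduced_word_drop: "reduced_word w \<Longrightarrow> reduced_word (drop n w)"
  by (simp add: reduced_word_def less_diff_conv add.commute)

text \<open>The occurrence for which the relation is solved. From length 3 on, the prefix that belongs to the second
  letter is neither empty nor all of \<open>w\<close>.\<close>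
definition pivot :: "group_word \<Rightarrow> nat" where
  "pivot w = (if length w \<ge> 3 then 1 else 0)"

definition offset :: "('a, 'b) monoid_scheme \<Rightarrow> (nat \<Rightarrow> 'a) \<Rightarrow> group_word \<Rightarrow> nat \<Rightarrow> 'a" where
  "offset G g w j = inv\<^bsub>G\<^esub> (prefix_value G g w (pivot w)) \<otimes>\<^bsub>G\<^esub> prefix_value G g w j"

definition other_occurrences :: "group_word \<Rightarrow> nat set" where
  "other_occurrences w = {j. j < length w \<and> j \<noteq> pivot w \<and> fst (w ! j) = fst (w ! pivot w)}"

lemma pivot_less: "w \<noteq> [] \<Longrightarrow> pivot w < length w"
  by (cases w) (auto simp: pivot_def)

lemma card_other_occurrences: "card (other_occurrences w) \<le> length w"
proof -
  have "other_occurrences w \<subseteq> {..<length w}" by (auto simp: other_occurrences_def)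
  then show ?thesis using card_mono[of "{..<length w}" "other_occurrences w"] by simp
qed

lemma finite_other_occurrences: "finite (other_occurrences w)"
  by (simp add: other_occurrences_def)

text \<open>Equality of two prefix lengths would mean adjacent letters \<open>i\<inverse>\<close> and \<open>i\<close>, against reducedness. The
  strict inequalities say that the two prefixes are not the empty word and the whole word, so that
  they differ by a proper subword of \<open>w\<close>; this is what the choice of the pivot achieves.\<close>
lemma prefix_len_pivot:
  assumes "reduced_word w" "j \<in> other_occurrences w"
  shows "prefix_len w j \<noteq> prefix_len w (pivot w)"
    and "prefix_len w j < prefix_len w (pivot w) + length w"
    and "prefix_len w (pivot w) < prefix_len w j + length w"
    and "prefix_len w j \<le> length w" "prefix_len w (pivot w) \<le> length w"
proof -
  have j: "j < length w" "j \<noteq> pivot w" "fst (w ! j) = fst (w ! pivot w)"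
    using assms(2) by (auto simp: other_occurrences_def)
  have red: "snd (w ! n) = snd (w ! Suc n)" if "Suc n < length w" "fst (w ! n) = fst (w ! Suc n)" for n
    using assms(1) that by (auto simp: reduced_word_def)
  have piv: "pivot w < length w" by (rule pivot_less) (use j(1) in auto)
  show "prefix_len w j \<noteq> prefix_len w (pivot w)"
  proof
    assume "prefix_len w j = prefix_len w (pivot w)"
    then consider "pivot w = Suc j" "snd (w ! j)" "\<not> snd (w ! pivot w)"
      | "j = Suc (pivot w)" "snd (w ! pivot w)" "\<not> snd (w ! j)"
      using j(2) by (simp add: prefix_len_def split: if_splits)
    then show False
      by cases (use red[of j] red[of "pivot w"] j(1,3) piv in metis)+
  qed
  have "prefix_len w j < prefix_len w (pivot w) + length w
      \<and> prefix_len w (pivot w) < prefix_len w j + length w"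
  proof (cases "length w \<ge> 3")
    case True
    then show ?thesis using j(1) by (simp add: prefix_len_def pivot_def)
  next
    case False
    then have "pivot w = 0" "j = 1" "length w = 2" using j(1,2) by (auto simp: pivot_def)
    then show ?thesis using red[of 0] j(3) by (simp add: prefix_len_def)
  qed
  then show "prefix_len w j < prefix_len w (pivot w) + length w"
      "prefix_len w (pivot w) < prefix_len w j + length w"
    by blast+
  show "prefix_len w j \<le> length w" "prefix_len w (pivot w) \<le> length w"
    using j(1) piv by (auto simp: prefix_len_def)
qed

lemma (in group) offset_eq_subword_value:
  assumes "reduced_word w" "j \<in> other_occurrences w"
  obtains u where "u \<noteq> []" "reduced_word u" "length u < length w"
    "\<And>g. (\<And>i. g i \<in> carrier G) \<Longrightarrow>
      offset G g w j = word_value G g u \<or> offset G g w j = inv (word_value G g u)"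
proof -
  note len = prefix_len_pivot[OF assms]
  define lo where "lo = min (prefix_len w j) (prefix_len w (pivot w))"
  define hi where "hi = max (prefix_len w j) (prefix_len w (pivot w))"
  define u where "u = drop lo (take hi w)"
  have bounds: "lo < hi" "hi \<le> length w" "hi < lo + length w"
    using len by (auto simp: lo_def hi_def)
  have split: "take hi w = take lo w @ u"
    unfolding u_def using bounds(1)
    by (metis append_take_drop_id less_imp_le min_def take_take)
  show thesis
  proof
    show "u \<noteq> []" "length u < length w" using bounds by (auto simp: u_def)
    show "reduced_word u" by (simp add: u_def assms(1) reduced_word_take reduced_word_drop)
    fix g :: "nat \<Rightarrow> 'a" assume g: "\<And>i. g i \<in> carrier G"
    let ?l = "word_value G g (take lo w)" and ?u = "word_value G g u"
    have hi_val: "word_value G g (take hi w) = ?l \<otimes> ?u"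
      by (simp add: split word_value_append g)
    have closed: "?l \<in> carrier G" "?u \<in> carrier G" using g by auto
    show "offset G g w j = ?u \<or> offset G g w j = inv ?u"
    proof (cases "prefix_len w (pivot w) < prefix_len w j")
      case True
      then have "offset G g w j = inv ?l \<otimes> (?l \<otimes> ?u)"
        using hi_val by (simp add: offset_def prefix_value_def lo_def hi_def)
      then show ?thesis using closed by (simp add: group_word_simps)
    next
      case False
      then have "offset G g w j = inv (?l \<otimes> ?u) \<otimes> ?l"
        using hi_val by (simp add: offset_def prefix_value_def lo_def hi_def)
      then show ?thesis using closed by (simp add: group_word_simps)
    qed
  qed
qed

section \<open>Words that are constant on a coset\<close>

definition finite_index_normal :: "'a set \<Rightarrow> ('a, 'b) monoid_scheme \<Rightarrow> bool" where
  "finite_index_normal D G \<longleftrightarrow> D \<lhd> G \<and> finite (rcosets\<^bsub>G\<^esub> D)"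

lemma (in group) r_coset_eq_iff:
  assumes "subgroup D G" "x \<in> carrier G" "y \<in> carrier G"
  shows "D #> x = D #> y \<longleftrightarrow> x \<otimes> inv y \<in> D"
  using assms subgroup.rcos_module[OF assms(1) is_group assms(3,2)]
  by (metis rcos_self repr_independence)

lemma (in group) finite_index_normal_carrier: "finite_index_normal (carrier G) G"
proof -
  have "rcosets (carrier G) \<subseteq> {carrier G}"
    by (auto simp: RCOSETS_def coset_join2 subgroup_self)
  moreover have "carrier G \<lhd> G" by (simp add: normal_inv_iff subgroup_self)
  ultimately show ?thesis
    unfolding finite_index_normal_def using finite_subset by blast
qed

text \<open>A coset of the intersection is the intersection of a coset of \<open>D\<close> with one of \<open>E\<close>.\<close>
lemma (in group) finite_index_normal_Int:
  assumes "finite_index_normal D G" "finite_index_normal E G"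
  shows "finite_index_normal (D \<inter> E) G"
proof -
  have D: "subgroup D G" and E: "subgroup E G" and DE: "D \<inter> E \<lhd> G"
    using assms normal_subgroup_intersect
    by (auto simp: finite_index_normal_def normal_imp_subgroup)
  have coset: "D \<inter> E #> x = (D #> x) \<inter> (E #> x)" if x: "x \<in> carrier G" for x
  proof
    show "(D #> x) \<inter> (E #> x) \<subseteq> D \<inter> E #> x"
    proof
      fix z assume z: "z \<in> (D #> x) \<inter> (E #> x)"
      then have "z \<in> carrier G" using subgroup.elemrcos_carrier[OF D is_group x] by blast
      then show "z \<in> D \<inter> E #> x"
        using z x subgroup.rcos_module[OF D is_group x] subgroup.rcos_module[OF E is_group x]
          subgroup.rcos_module[OF normal_imp_subgroup[OF DE] is_group x] by blast
    qed
  qed (auto simp: r_coset_def)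
  have "rcosets (D \<inter> E) \<subseteq> (\<lambda>(P, Q). P \<inter> Q) ` ((rcosets D) \<times> (rcosets E))"
  proof
    fix c assume "c \<in> rcosets (D \<inter> E)"
    then obtain x where x: "x \<in> carrier G" "c = (D #> x) \<inter> (E #> x)"
      using coset by (auto simp: RCOSETS_def)
    then show "c \<in> (\<lambda>(P, Q). P \<inter> Q) ` ((rcosets D) \<times> (rcosets E))"
      using rcosetsI[OF subgroup.subset[OF D]] rcosetsI[OF subgroup.subset[OF E]] by force
  qed
  then show ?thesis
    using assms DE finite_subset unfolding finite_index_normal_def by blast
qed

lemma (in group) residually_finite_separates:
  assumes "residually_finite G" "finite F" "F \<subseteq> carrier G - {\<one>}" "finite_index_normal D G"
  obtains E where "finite_index_normal E G" "E \<subseteq> D" "E \<inter> F = {}"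
proof -
  have "\<exists>E. finite_index_normal E G \<and> E \<subseteq> D \<and> E \<inter> F = {}"
    using assms(2,3)
  proof (induction F rule: finite_induct)
    case empty
    then show ?case using assms(4) by auto
  next
    case (insert x F)
    then obtain E where E: "finite_index_normal E G" "E \<subseteq> D" "E \<inter> F = {}" by auto
    obtain M where "finite_index_normal M G" "x \<notin> M"
      using assms(1) insert.prems unfolding residually_finite_def finite_index_normal_def by blast
    with E show ?case
      by (intro exI[of _ "E \<inter> M"]) (auto intro: finite_index_normal_Int)
  qed
  then show thesis using that by blast
qed

definition coset_tuples :: "('a, 'b) monoid_scheme \<Rightarrow> 'a set \<Rightarrow> (nat \<Rightarrow> 'a) \<Rightarrow> (nat \<Rightarrow> 'a) set" where
  "coset_tuples G D y = {g. \<forall>i. g i \<in> carrier G \<and> g i \<otimes>\<^bsub>G\<^esub> inv\<^bsub>G\<^esub> (y i) \<in> D}"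

definition coset_constant :: "('a, 'b) monoid_scheme \<Rightarrow> group_word \<Rightarrow> bool" where
  "coset_constant G w \<longleftrightarrow> (\<exists>D y. finite_index_normal D G \<and> (\<forall>i. y i \<in> carrier G) \<and>
     (\<forall>g \<in> coset_tuples G D y. word_value G g w = word_value G y w))"

lemma (in group) coset_tuples_self:
  "subgroup D G \<Longrightarrow> (\<And>i. y i \<in> carrier G) \<Longrightarrow> y \<in> coset_tuples G D y"
  by (simp add: coset_tuples_def subgroup.one_closed)

lemma (in group) coset_tuples_trans:
  assumes "subgroup D G" "E \<subseteq> D" "\<And>i. y i \<in> carrier G"
    and "y' \<in> coset_tuples G D y" "g \<in> coset_tuples G E y'"
  shows "g \<in> coset_tuples G D y"
proof -
  have "g i \<otimes> inv (y i) \<in> D" for i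
  proof -
    have closed: "g i \<in> carrier G" "y' i \<in> carrier G" "y i \<in> carrier G"
      using assms(3-5) by (auto simp: coset_tuples_def)
    have "(g i \<otimes> inv (y' i)) \<otimes> (y' i \<otimes> inv (y i)) \<in> D"
      by (rule subgroup.m_closed[OF assms(1)]) (use assms in \<open>auto simp: coset_tuples_def\<close>)
    then show ?thesis using closed by (simp add: group_word_simps)
  qed
  then show ?thesis using assms(5) by (auto simp: coset_tuples_def)
qed

text \<open>If \<open>u\<close> takes two values on a coset, at least one of them differs from \<open>z\<close>, and by residual finiteness
  the inequality persists on a smaller coset. Thus finitely many forbidden values can be avoided one
  after the other.\<close>
lemma (in group) coset_tuples_avoiding:
  assumes "residually_finite G" "finite_index_normal D G" "\<And>i. y i \<in> carrier G"
    and "finite P" "\<And>u z. (u, z) \<in> P \<Longrightarrow> \<not> coset_constant G u \<and> z \<in> carrier G"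
  obtains g where "g \<in> coset_tuples G D y" "\<And>u z. (u, z) \<in> P \<Longrightarrow> word_value G g u \<noteq> z"
proof -
  have D: "subgroup D G" using assms(2) by (simp add: finite_index_normal_def normal_imp_subgroup)
  \<comment> \<open>A whole smaller coset is kept at each stage, so that later choices stay inside it.\<close>
  have "\<exists>E y'. finite_index_normal E G \<and> E \<subseteq> D \<and> y' \<in> coset_tuples G D y \<and>
      (\<forall>g \<in> coset_tuples G E y'. \<forall>(u, z) \<in> P. word_value G g u \<noteq> z)"
    using assms(4,5)
  proof (induction P rule: finite_induct)
    case empty
    then show ?case using assms(2,3) coset_tuples_self[OF D] by auto
  next
    case (insert p P)
    obtain u z where p: "p = (u, z)" by force
    have z: "z \<in> carrier G" and nc: "\<not> coset_constant G u"
      using insert.prems[of u z] p by auto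
    obtain E y' where E: "finite_index_normal E G" "E \<subseteq> D" and y': "y' \<in> coset_tuples G D y"
      and P: "\<forall>g \<in> coset_tuples G E y'. \<forall>(u, z) \<in> P. word_value G g u \<noteq> z"
      using insert.IH insert.prems by (metis insertCI)
    have subE: "subgroup E G" using E(1) by (simp add: finite_index_normal_def normal_imp_subgroup)
    have y'_closed: "y' i \<in> carrier G" for i using y' by (simp add: coset_tuples_def)
    obtain x where x: "x \<in> coset_tuples G E y'" "word_value G x u \<noteq> z"
      using nc E(1) y'_closed coset_tuples_self[OF subE, of y']
      unfolding coset_constant_def by metis
    have x_closed: "x i \<in> carrier G" for i using x(1) by (simp add: coset_tuples_def)
    then have val: "word_value G x u \<in> carrier G" by blast
    have "z \<otimes> inv (word_value G x u) \<noteq> \<one>"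
      using x(2) z val by (metis inv_equality inv_inv inv_closed)
    then obtain M where M: "finite_index_normal M G" "M \<subseteq> E" "z \<otimes> inv (word_value G x u) \<notin> M"
      using residually_finite_separates[OF assms(1) _ _ E(1), of "{z \<otimes> inv (word_value G x u)}"]
        z val by auto
    have "word_value G g u' \<noteq> z'"
      if g: "g \<in> coset_tuples G M x" and uz: "(u', z') \<in> insert p P" for g u' z'
    proof (cases "(u', z') = p")
      case True
      have "word_value G g u \<otimes> inv (word_value G x u) \<in> M"
        using g M(1) x_closed
        by (intro word_value_normal_cong) (auto simp: coset_tuples_def finite_index_normal_def)
      then show ?thesis using M(3) True p by auto
    next
      case False
      then show ?thesis
        using coset_tuples_trans[OF subE M(2) y'_closed x(1) g] P uz by auto
    qed
    then show ?case
      using M E(2) coset_tuples_trans[OF D E(2) assms(3) y' x(1)]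
      by (intro exI[of _ M] exI[of _ x]) auto
  qed
  then obtain E y' where E: "finite_index_normal E G" "y' \<in> coset_tuples G D y"
    and P: "\<forall>g \<in> coset_tuples G E y'. \<forall>(u, z) \<in> P. word_value G g u \<noteq> z"
    by auto
  have "y' \<in> coset_tuples G E y'"
    using E by (intro coset_tuples_self)
      (auto simp: finite_index_normal_def normal_imp_subgroup coset_tuples_def)
  with P E(2) show thesis by (intro that[of y']) auto
qed

definition group_law :: "('a, 'b) monoid_scheme \<Rightarrow> group_word \<Rightarrow> bool" where
  "group_law G w \<longleftrightarrow> (\<forall>g. (\<forall>i. g i \<in> carrier G) \<longrightarrow> word_value G g w = \<one>\<^bsub>G\<^esub>)"

text \<open>Passing from laws to words that are constant on some coset is what makes a minimal word useful:
  that a shorter word is not a law would not help, because the tuples have to stay inside a coset on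
  which \<open>v\<close> is constant.\<close>
lemma (in group) minimal_coset_constant_word:
  assumes "group_law G w" "w \<noteq> []" "reduced_word w"
  obtains v where "coset_constant G v" "v \<noteq> []" "reduced_word v" "length v \<le> length w"
    "\<And>u. u \<noteq> [] \<Longrightarrow> reduced_word u \<Longrightarrow> length u < length v \<Longrightarrow> \<not> coset_constant G u"
proof -
  let ?P = "\<lambda>v. v \<noteq> [] \<and> reduced_word v \<and> coset_constant G v"
  have "coset_constant G w"
    using assms(1) finite_index_normal_carrier
    unfolding coset_constant_def group_law_def coset_tuples_def
    by (intro exI[of _ "carrier G"] exI[of _ "\<lambda>_. \<one>"]) auto
  then have "?P w" using assms by simp
  then obtain v where "?P v" "\<forall>u. ?P u \<longrightarrow> length v \<le> length u"
    using ex_has_least_nat[of ?P w length] by blast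
  then show thesis using \<open>?P w\<close> by (intro that[of v]) (meson not_less)+
qed

text \<open>The offsets are values of words shorter than \<open>v\<close>, or inverses of such values, so a further tuple can
  always be chosen to avoid the finitely many offsets of the earlier tuples.\<close>
lemma (in group) tuples_with_disjoint_offsets:
  assumes "residually_finite G" "finite_index_normal D G" "\<And>i. y i \<in> carrier G" "reduced_word v"
    and minimal: "\<And>u. u \<noteq> [] \<Longrightarrow> reduced_word u \<Longrightarrow> length u < length v \<Longrightarrow> \<not> coset_constant G u"
  obtains g :: "nat \<Rightarrow> nat \<Rightarrow> 'a" where "\<And>l. l < N \<Longrightarrow> g l \<in> coset_tuples G D y"
    "\<And>l l' j j'. l' < l \<Longrightarrow> l < N \<Longrightarrow> j \<in> other_occurrences v \<Longrightarrow> j' \<in> other_occurrences v \<Longrightarrow>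
      offset G (g l) v j \<noteq> offset G (g l') v j'"
proof -
  let ?J = "other_occurrences v"
  have "\<exists>u. u \<noteq> [] \<and> reduced_word u \<and> length u < length v \<and> (\<forall>g. (\<forall>i. g i \<in> carrier G) \<longrightarrow>
      offset G g v j = word_value G g u \<or> offset G g v j = inv (word_value G g u))" if "j \<in> ?J" for j
    using offset_eq_subword_value[OF assms(4) that] by metis
  then obtain u where u: "\<And>j. j \<in> ?J \<Longrightarrow> u j \<noteq> [] \<and> reduced_word (u j) \<and> length (u j) < length v"
    and val: "\<And>j g. j \<in> ?J \<Longrightarrow> (\<And>i. g i \<in> carrier G) \<Longrightarrow>
      offset G g v j = word_value G g (u j) \<or> offset G g v j = inv (word_value G g (u j))"
    by metis
  have "\<exists>g. (\<forall>l<N. g l \<in> coset_tuples G D y) \<and>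
      (\<forall>l<N. \<forall>l'<l. \<forall>j\<in>?J. \<forall>j'\<in>?J. offset G (g l) v j \<noteq> offset G (g l') v j')"
  proof (induction N)
    case 0
    then show ?case by simp
  next
    case (Suc N)
    then obtain g where g: "\<And>l. l < N \<Longrightarrow> g l \<in> coset_tuples G D y"
      and disj: "\<forall>l<N. \<forall>l'<l. \<forall>j\<in>?J. \<forall>j'\<in>?J. offset G (g l) v j \<noteq> offset G (g l') v j'"
      by blast
    define Z where "Z = (\<lambda>(l, j). offset G (g l) v j) ` ({..<N} \<times> ?J)"
    have Z: "finite Z" "Z \<subseteq> carrier G"
      using g finite_other_occurrences by (auto simp: Z_def offset_def coset_tuples_def)
    \<comment> \<open>An offset is the value of \<open>u j\<close> or its inverse, so the inverses of the old offsets are avoided too.\<close>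
    define P where "P = (\<lambda>(j, z). (u j, z)) ` (?J \<times> (Z \<union> m_inv G ` Z))"
    have in_P: "(u j, z) \<in> P" if "j \<in> ?J" "z \<in> Z \<union> m_inv G ` Z" for j z
      unfolding P_def using that by (intro image_eqI[of _ _ "(j, z)"]) auto
    have fin_P: "finite P" using Z finite_other_occurrences by (simp add: P_def)
    have P: "\<not> coset_constant G u' \<and> z \<in> carrier G" if "(u', z) \<in> P" for u' z
      using that Z(2) minimal u unfolding P_def by auto
    obtain x where x: "x \<in> coset_tuples G D y"
      and avoid: "\<And>u z. (u, z) \<in> P \<Longrightarrow> word_value G x u \<noteq> z"
      by (rule coset_tuples_avoiding[OF assms(1,2) _ fin_P, of y]) (use assms(3) P in blast)+
    have x_closed: "x i \<in> carrier G" for i using x by (simp add: coset_tuples_def)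
    have "offset G x v j \<noteq> z" if "j \<in> ?J" "z \<in> Z" for j z
    proof -
      have "word_value G x (u j) \<noteq> z" "word_value G x (u j) \<noteq> inv z"
        using that by (auto intro!: avoid in_P)
      then show ?thesis
        using val[OF that(1), of x] x_closed Z(2) that(2)
        by (metis inv_inv word_value_closed)
    qed
    then have "offset G x v j \<noteq> offset G (g l) v j'" if "l < N" "j \<in> ?J" "j' \<in> ?J" for l j j'
      using that by (auto simp: Z_def)
    then show ?case
      using x g disj by (intro exI[of _ "g(N := x)"]) (simp add: less_Suc_eq all_conj_distrib)
  qed
  then show thesis using that by metis
qed

section \<open>Schreier generators and the relations between them\<close>

definition coset_rep :: "'a set \<Rightarrow> 'a" where
  "coset_rep c = (SOME z. z \<in> c)"

definition schreier_gen :: "('a, 'b) monoid_scheme \<Rightarrow> 'a set \<Rightarrow> 'a set \<Rightarrow> 'a \<Rightarrow> 'a" where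
  "schreier_gen G D c x =
     coset_rep c \<otimes>\<^bsub>G\<^esub> x \<otimes>\<^bsub>G\<^esub> inv\<^bsub>G\<^esub> (coset_rep (D #>\<^bsub>G\<^esub> (coset_rep c \<otimes>\<^bsub>G\<^esub> x)))"

text \<open>The failure of the chosen representatives to be compatible with left translation by \<open>s\<close>.\<close>
definition translation_defect :: "('a, 'b) monoid_scheme \<Rightarrow> 'a set \<Rightarrow> 'a \<Rightarrow> 'a set \<Rightarrow> 'a" where
  "translation_defect G D s c =
     s \<otimes>\<^bsub>G\<^esub> coset_rep c \<otimes>\<^bsub>G\<^esub> inv\<^bsub>G\<^esub> (coset_rep (D #>\<^bsub>G\<^esub> (s \<otimes>\<^bsub>G\<^esub> coset_rep c)))"

lemma (in group) coset_rep:
  assumes "subgroup D G" "c \<in> rcosets D"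
  shows "coset_rep c \<in> carrier G" "D #> coset_rep c = c"
proof -
  obtain x where x: "x \<in> carrier G" "c = D #> x" using assms(2) by (auto simp: RCOSETS_def)
  then have "x \<in> c" using assms(1) rcos_self by blast
  then have "coset_rep c \<in> c" unfolding coset_rep_def by (rule someI)
  then show "coset_rep c \<in> carrier G" "D #> coset_rep c = c"
    using x assms(1) subgroup.elemrcos_carrier[OF assms(1) is_group x(1)] repr_independence
    by metis+
qed

lemma (in group) coset_rep_r_coset:
  assumes "subgroup D G" "x \<in> carrier G"
  shows "coset_rep (D #> x) \<in> carrier G" "D #> coset_rep (D #> x) = D #> x"
    "x \<otimes> inv (coset_rep (D #> x)) \<in> D"
proof -
  have "D #> x \<in> rcosets D" using assms by (simp add: rcosetsI subgroup.subset)
  note rep = coset_rep[OF assms(1) this]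
  show "coset_rep (D #> x) \<in> carrier G" "D #> coset_rep (D #> x) = D #> x"
    using rep .
  show "x \<otimes> inv (coset_rep (D #> x)) \<in> D"
    using rep r_coset_eq_iff[OF assms rep(1)] by simp
qed

lemma (in group) r_coset_mult_cong:
  assumes "subgroup D G" "x \<in> carrier G" "y \<in> carrier G" "z \<in> carrier G" "D #> x = D #> y"
  shows "D #> (x \<otimes> z) = D #> (y \<otimes> z)"
  using assms by (metis coset_mult_assoc subgroup.subset)

lemma (in group) r_coset_mult_left_cong:
  assumes "D \<lhd> G" "x \<in> carrier G" "y \<in> carrier G" "z \<in> carrier G" "D #> x = D #> y"
  shows "D #> (z \<otimes> x) = D #> (z \<otimes> y)"
proof -
  note D = normal_imp_subgroup[OF assms(1)]
  have "z \<otimes> (x \<otimes> inv y) \<otimes> inv z \<in> D"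
    using assms r_coset_eq_iff[OF D] by (intro normal.inv_op_closed2) auto
  then have "(z \<otimes> x) \<otimes> inv (z \<otimes> y) \<in> D"
    using assms by (simp add: group_word_simps)
  then show ?thesis using r_coset_eq_iff[OF D, of "z \<otimes> x" "z \<otimes> y"] assms by simp
qed

lemma (in group) schreier_gen_in:
  assumes "subgroup D G" "c \<in> rcosets D" "x \<in> carrier G"
  shows "schreier_gen G D c x \<in> D"
  unfolding schreier_gen_def
  using coset_rep_r_coset(3)[OF assms(1), of "coset_rep c \<otimes> x"] coset_rep[OF assms(1,2)] assms(3)
  by simp

lemma (in group) translation_defect_in:
  assumes "subgroup D G" "c \<in> rcosets D" "s \<in> carrier G"
  shows "translation_defect G D s c \<in> D"
  unfolding translation_defect_def
  using coset_rep_r_coset(3)[OF assms(1), of "s \<otimes> coset_rep c"] coset_rep[OF assms(1,2)] assms(3)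
  by simp

text \<open>Conjugation by \<open>s\<close> carries the path of the Schreier graph that spells \<open>x\<close> from \<open>c\<close> to the path that spells \<open>x\<close> from \<open>s c\<close>; the
  defects compare the translated representatives of its end points with the chosen ones.\<close>
lemma (in group) conj_schreier_gen:
  assumes "D \<lhd> G" "c \<in> rcosets D" "x \<in> carrier G" "s \<in> carrier G"
  shows "s \<otimes> schreier_gen G D c x \<otimes> inv s =
    translation_defect G D s c \<otimes> schreier_gen G D (D #> (s \<otimes> coset_rep c)) x
      \<otimes> inv (translation_defect G D s (D #> (coset_rep c \<otimes> x)))"
proof -
  note D = normal_imp_subgroup[OF assms(1)]
  define y where "y = coset_rep c"
  define y1 where "y1 = coset_rep (D #> (s \<otimes> y))"
  define y2 where "y2 = coset_rep (D #> (y \<otimes> x))"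
  define r where "r = coset_rep (D #> (y1 \<otimes> x))"
  have y: "y \<in> carrier G" unfolding y_def by (rule coset_rep(1)[OF D assms(2)])
  have y1: "y1 \<in> carrier G" "D #> y1 = D #> (s \<otimes> y)"
    unfolding y1_def using y assms(4) by (simp_all add: coset_rep_r_coset[OF D])
  have y2: "y2 \<in> carrier G" "D #> y2 = D #> (y \<otimes> x)"
    unfolding y2_def using y assms(3) by (simp_all add: coset_rep_r_coset[OF D])
  have r: "r \<in> carrier G" unfolding r_def using y1(1) assms(3) by (simp add: coset_rep_r_coset[OF D])
  have "D #> (y1 \<otimes> x) = D #> (s \<otimes> y \<otimes> x)"
    using y y1 assms by (intro r_coset_mult_cong[OF D]) auto
  also have "\<dots> = D #> (s \<otimes> y2)"
    using r_coset_mult_left_cong[OF assms(1), of "y \<otimes> x" y2 s] y y2 assms by (simp add: m_assoc)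
  finally have r': "coset_rep (D #> (s \<otimes> y2)) = r" by (simp add: r_def)
  have "schreier_gen G D c x = y \<otimes> x \<otimes> inv y2"
      "translation_defect G D s c = s \<otimes> y \<otimes> inv y1"
      "schreier_gen G D (D #> (s \<otimes> coset_rep c)) x = y1 \<otimes> x \<otimes> inv r"
      "translation_defect G D s (D #> (coset_rep c \<otimes> x)) = s \<otimes> y2 \<otimes> inv r"
    using r' by (simp_all add: schreier_gen_def translation_defect_def y_def y1_def y2_def r_def)
  then show ?thesis
    using y y1(1) y2(1) r assms(3,4) by (simp add: group_word_simps)
qed

text \<open>Schreier's lemma. The representative \<open>r\<close> of the trivial coset need not be \<open>\<one>\<close>; an element \<open>d\<close> of \<open>D\<close> is
  reached by rewriting \<open>r\<inverse> d r\<close> instead.\<close>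
lemma (in group) schreier_gens_generate:
  assumes "subgroup D G" "generate G A = carrier G" "A \<subseteq> carrier G"
    and "subgroup H G" "H \<subseteq> D"
    and gens: "\<And>c x. c \<in> rcosets D \<Longrightarrow> x \<in> A \<Longrightarrow> schreier_gen G D c x \<in> H"
  shows "H = D"
proof
  let ?r = "\<lambda>y. coset_rep (D #> y)"
  have r: "?r y \<in> carrier G" if "y \<in> carrier G" for y
    using coset_rep_r_coset[OF assms(1) that] by simp
  have cong: "?r (?r y \<otimes> x) = ?r (y \<otimes> x)" if "x \<in> carrier G" "y \<in> carrier G" for x y
    using coset_rep_r_coset[OF assms(1) that(2)] that
    by (metis r_coset_mult_cong[OF assms(1)])
  have word: "?r y \<otimes> x \<otimes> inv (?r (y \<otimes> x)) \<in> H" if "x \<in> A" "y \<in> carrier G" for x y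
    using gens[of "D #> y" x] that assms(3) cong[of x y]
    by (auto simp: schreier_gen_def rcosetsI subgroup.subset[OF assms(1)])
  have main: "\<forall>y \<in> carrier G. ?r y \<otimes> g \<otimes> inv (?r (y \<otimes> g)) \<in> H" if "g \<in> generate G A" for g
    using that
  proof (induction rule: generate.induct)
    case one
    then show ?case using r subgroup.one_closed[OF assms(4)] by simp
  next
    case (incl h)
    then show ?case using word by simp
  next
    case (inv x)
    show ?case
    proof
      fix y assume y: "y \<in> carrier G"
      have x: "x \<in> carrier G" using inv assms(3) by blast
      have "inv (?r (y \<otimes> inv x) \<otimes> x \<otimes> inv (?r (y \<otimes> inv x \<otimes> x))) \<in> H"
        using word[OF inv, of "y \<otimes> inv x"] x y by (intro subgroup.m_inv_closed[OF assms(4)]) simp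
      then show "?r y \<otimes> inv x \<otimes> inv (?r (y \<otimes> inv x)) \<in> H"
        using x y r by (simp add: group_word_simps)
    qed
  next
    case (eng g h)
    show ?case
    proof
      fix y assume y: "y \<in> carrier G"
      have gh: "g \<in> carrier G" "h \<in> carrier G"
        using eng(1,2) assms(3) generate_in_carrier by auto
      have "(?r y \<otimes> g \<otimes> inv (?r (y \<otimes> g))) \<otimes> (?r (y \<otimes> g) \<otimes> h \<otimes> inv (?r (y \<otimes> g \<otimes> h))) \<in> H"
        by (rule subgroup.m_closed[OF assms(4)]) (use eng(3,4) y gh in auto)
      then show "?r y \<otimes> (g \<otimes> h) \<otimes> inv (?r (y \<otimes> (g \<otimes> h))) \<in> H"
        using y gh r by (simp add: group_word_simps)
    qed
  qed
  show "D \<subseteq> H"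
  proof
    fix d assume d: "d \<in> D"
    let ?e = "?r \<one>"
    have e: "?e \<in> carrier G" using r by simp
    have "inv ?e \<in> D" using coset_rep_r_coset(3)[OF assms(1), of \<one>] e by simp
    then have eD: "?e \<in> D" using subgroup.m_inv_closed[OF assms(1), of "inv ?e"] e by simp
    define g where "g = inv ?e \<otimes> d \<otimes> ?e"
    have dG: "d \<in> carrier G" using d subgroup.mem_carrier[OF assms(1)] by simp
    have g: "g \<in> D" unfolding g_def
      using \<open>inv ?e \<in> D\<close> eD d by (intro subgroup.m_closed[OF assms(1)])
    then have gG: "g \<in> carrier G" using subgroup.mem_carrier[OF assms(1)] by simp
    have "D #> g = D #> \<one>"
      using g assms(1) is_group by (simp add: subgroup.rcos_const subgroup.subset)
    then have "?e \<otimes> g \<otimes> inv ?e \<in> H"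
      using main[of g] gG assms(2) by (metis l_one one_closed)
    then show "d \<in> H" unfolding g_def using e dG by (simp add: group_word_simps)
  qed
qed (fact assms(5))

lemma (in group) schreier_bound:
  assumes "subgroup D G" "finite (rcosets D)" "finite A" "A \<subseteq> carrier G" "generate G A = carrier G"
  obtains E where "finite E" "E \<subseteq> D" "generate G E = D" "card E \<le> card A * card (rcosets D)"
proof
  let ?E = "(\<lambda>(c, x). schreier_gen G D c x) ` ((rcosets D) \<times> A)"
  show "finite ?E" using assms by simp
  show sub: "?E \<subseteq> D" using assms schreier_gen_in by auto
  have "?E \<subseteq> carrier G" using sub subgroup.subset[OF assms(1)] by blast
  show "generate G ?E = D"
    by (rule schreier_gens_generate[OF assms(1,5,4) generate_is_subgroup[OF \<open>?E \<subseteq> carrier G\<close>]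
          generate_subgroup_incl[OF sub assms(1)]])
      (auto intro!: generate.incl)
  show "card ?E \<le> card A * card (rcosets D)"
    using card_image_le[of "(rcosets D) \<times> A" "\<lambda>(c, x). schreier_gen G D c x"] assms
    by (simp add: card_cartesian_product mult.commute)
qed

text \<open>The generating set consists of the Schreier generators at the points of a small spanning
  set \<open>S\<close>, those at the points \<open>U\<close> that \<open>S\<close> does not reach, and all translation
  defects of the offsets. At any other point \<open>c\<close> the relation of one of the \<open>N\<close> tuples, applied to a
  Schreier generator \<open>a\<close> at \<open>c\<close>, expresses \<open>a\<close> through its conjugates by the offsets, which
  involve only Schreier generators over \<open>S\<close> and defects. The bound is in terms of the law \<open>w\<close> and
  not of the shorter word \<open>v\<close>, which depends on the group: thus \<open>N\<close> can be fixed before the group is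
  replaced by a subgroup.\<close>
lemma (in group) finite_index_subgroup_few_generators:
  assumes "residually_finite G" "group_law G w" "w \<noteq> []" "reduced_word w"
    and A: "finite A" "A \<subseteq> carrier G" "generate G A = carrier G"
    and q: "0 < q" "q < 1"
  obtains D E where "finite_index_normal D G" "finite E" "E \<subseteq> D" "generate G E = D"
    "real (card E) \<le> (real (card A) * (q + (1 - q ^ length w) ^ N) + real (N * length w))
       * real (card (rcosets D))"
proof -
  obtain v where v: "coset_constant G v" "v \<noteq> []" "reduced_word v" "length v \<le> length w"
    and minimal: "\<And>u. u \<noteq> [] \<Longrightarrow> reduced_word u \<Longrightarrow> length u < length v \<Longrightarrow> \<not> coset_constant G u"
    using minimal_coset_constant_word[OF assms(2-4)] by metis
  obtain D1 y where D1: "finite_index_normal D1 G" and y: "\<And>i. y i \<in> carrier G"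
    and const: "\<And>g. g \<in> coset_tuples G D1 y \<Longrightarrow> word_value G g v = word_value G y v"
    using v(1) unfolding coset_constant_def by metis
  let ?J = "other_occurrences v"
  obtain g where g: "\<And>l. l < N \<Longrightarrow> g l \<in> coset_tuples G D1 y"
    and disj: "\<And>l l' j j'. l' < l \<Longrightarrow> l < N \<Longrightarrow> j \<in> ?J \<Longrightarrow> j' \<in> ?J \<Longrightarrow>
      offset G (g l) v j \<noteq> offset G (g l') v j'"
    by (rule tuples_with_disjoint_offsets[OF assms(1) D1 _ v(3), of y N])
      (use y minimal in blast)+
  define s where "s l j = offset G (g l) v j" for l j
  have gG: "g l i \<in> carrier G" if "l < N" for l i using g[OF that] by (simp add: coset_tuples_def)
  have sG: "s l j \<in> carrier G" if "l < N" for l j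
    using gG[OF that] by (simp add: s_def offset_def)
  \<comment> \<open>These elements are to stay nontrivial modulo \<open>D\<close>, which keeps the blocks of different tuples disjoint in every translate.\<close>
  define F where "F = (\<lambda>((l, l'), j, j'). s l j \<otimes> inv (s l' j')) `
    ((SIGMA l:{..<N}. {..<l}) \<times> ?J \<times> ?J)"
  have in_F: "s l j \<otimes> inv (s l' j') \<in> F" if "l' < l" "l < N" "j \<in> ?J" "j' \<in> ?J" for l l' j j'
    unfolding F_def using that by (intro image_eqI[of _ _ "((l, l'), j, j')"]) auto
  have finF: "finite F"
    unfolding F_def using finite_other_occurrences by (intro finite_imageI finite_cartesian_product) auto
  have "F \<subseteq> carrier G - {\<one>}"
  proof
    fix z assume "z \<in> F"
    then obtain l l' j j' where z: "z = s l j \<otimes> inv (s l' j')" "l' < l" "l < N" "j \<in> ?J" "j' \<in> ?J"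
      by (auto simp: F_def)
    then have "s l j \<noteq> s l' j'" "s l j \<in> carrier G" "s l' j' \<in> carrier G"
      using disj sG by (auto simp: s_def)
    then show "z \<in> carrier G - {\<one>}"
      unfolding z(1) by (metis Diff_iff inv_closed inv_equality inv_inv m_closed singletonD)
  qed
  then obtain D where D: "finite_index_normal D G" "D \<subseteq> D1" "D \<inter> F = {}"
    using residually_finite_separates[OF assms(1) finF _ D1] by blast
  have normD: "D \<lhd> G" and finQ: "finite (rcosets D)"
    using D(1) by (auto simp: finite_index_normal_def)
  note subD = normal_imp_subgroup[OF normD]
  let ?Q = "rcosets D"
  define B where "B l c = (\<lambda>j. D #> (s l j \<otimes> coset_rep c)) ` ?J" for l c
  have B_sub: "B l c \<subseteq> ?Q \<and> card (B l c) \<le> length w" if "l < N" "c \<in> ?Q" for l c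
  proof
    show "B l c \<subseteq> ?Q"
      unfolding B_def using sG[OF that(1)] coset_rep[OF subD that(2)] subgroup.subset[OF subD]
      by (auto intro!: rcosetsI)
    show "card (B l c) \<le> length w"
      unfolding B_def using card_image_le[OF finite_other_occurrences] card_other_occurrences[of v] v(4)
        le_trans by blast
  qed
  have B_ne: "D #> (s l j \<otimes> coset_rep c) \<noteq> D #> (s l' j' \<otimes> coset_rep c)"
    if "l' < l" "l < N" "j \<in> ?J" "j' \<in> ?J" "c \<in> ?Q" for l l' j j' c
  proof
    assume "D #> (s l j \<otimes> coset_rep c) = D #> (s l' j' \<otimes> coset_rep c)"
    then have "s l j \<otimes> coset_rep c \<otimes> inv (s l' j' \<otimes> coset_rep c) \<in> D"
      using r_coset_eq_iff[OF subD] sG that coset_rep[OF subD that(5)] by simp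
    then have "s l j \<otimes> inv (s l' j') \<in> D"
      using sG that coset_rep[OF subD that(5)] by (simp add: group_word_simps)
    then show False using D(3) in_F[OF that(1-4)] by blast
  qed
  have B_disj: "disjoint_family_on (\<lambda>l. B l c) {..<N}" if c: "c \<in> ?Q" for c
    unfolding disjoint_family_on_def
  proof (intro ballI impI)
    fix l l' assume "l \<in> {..<N}" "l' \<in> {..<N}" "l \<noteq> l'"
    then consider "l' < l" "l < N" | "l < l'" "l' < N" by fastforce
    then show "B l c \<inter> B l' c = {}"
      by cases (use B_ne c in \<open>unfold B_def, blast+\<close>)
  qed
  obtain S where S: "S \<subseteq> ?Q"
    and S_card: "real (card S + card {c \<in> ?Q. \<forall>l<N. \<not> B l c \<subseteq> S})
      \<le> (q + (1 - q ^ length w) ^ N) * real (card ?Q)"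
    using exists_small_spanning_subset[OF finQ q, of N B "length w"] B_sub B_disj by blast
  define U where "U = {c \<in> ?Q. \<forall>l<N. \<not> B l c \<subseteq> S}"
  define E1 where "E1 = (\<lambda>(c, x). schreier_gen G D c x) ` ((S \<union> U) \<times> A)"
  define E2 where "E2 = (\<lambda>((l, j), c). translation_defect G D (s l j) c) ` (({..<N} \<times> ?J) \<times> ?Q)"
  have finSU: "finite S" "finite U" using finQ S finite_subset by (auto simp: U_def)
  have fin: "finite (E1 \<union> E2)"
    using finSU A(1) finQ finite_other_occurrences by (simp add: E1_def E2_def)
  have E_sub: "E1 \<union> E2 \<subseteq> D"
    unfolding E1_def E2_def U_def
    using S A(2) sG by (auto intro!: schreier_gen_in[OF subD] translation_defect_in[OF subD])
  define H where "H = generate G (E1 \<union> E2)"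
  have subH: "subgroup H G"
    unfolding H_def using E_sub subgroup.subset[OF subD] by (intro generate_is_subgroup) blast
  have E_H: "e \<in> H" if "e \<in> E1 \<union> E2" for e
    unfolding H_def using that by (rule generate.incl)
  have gens: "schreier_gen G D c x \<in> H" if c: "c \<in> ?Q" and x: "x \<in> A" for c x
  proof (cases "c \<in> S \<union> U")
    case True
    then show ?thesis using x by (intro E_H) (auto simp: E1_def)
  next
    case False
    then obtain l where l: "l < N" "B l c \<subseteq> S" using c by (auto simp: U_def)
    let ?a = "schreier_gen G D c x" and ?i = "fst (v ! pivot v)"
    let ?t = "\<lambda>j. prefix_value G (g l) v j"
    have xG: "x \<in> carrier G" using x A(2) by blast
    have aD: "?a \<in> D" by (rule schreier_gen_in[OF subD c xG])
    then have aG: "?a \<in> carrier G" using subgroup.mem_carrier[OF subD] by blast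
    have tG: "?t j \<in> carrier G" for j using gG[OF l(1)] by blast
    have "(g l)(?i := ?a \<otimes> g l ?i) \<in> coset_tuples G D1 (g l)"
      using aD aG D(2) gG[OF l(1)] subgroup.one_closed[OF subD]
      by (auto simp: coset_tuples_def group_word_simps)
    then have "(g l)(?i := ?a \<otimes> g l ?i) \<in> coset_tuples G D1 y"
      using coset_tuples_trans[OF _ order_refl y g[OF l(1)]] D1
      by (simp add: finite_index_normal_def normal_imp_subgroup)
    then have same: "word_value G ((g l)(?i := ?a \<otimes> g l ?i)) v = word_value G (g l) v"
      using const g[OF l(1)] by simp
    \<comment> \<open>The choice \<open>c = inv (?t (pivot v))\<close> turns the conjugating prefix values into offsets and that of the pivot into \<open>\<one>\<close>.\<close>
    have "inv (?t (pivot v)) \<otimes> ?t (pivot v) \<otimes> ?a \<otimes> inv (inv (?t (pivot v)) \<otimes> ?t (pivot v)) \<in> H"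
    proof (rule word_value_perturb_solve[OF subH gG[OF l(1)] aG _ pivot_less[OF v(2)] refl same])
      show "inv (?t (pivot v)) \<in> carrier G" using tG by simp
      fix j assume "j < length v" "j \<noteq> pivot v" "fst (v ! j) = ?i"
      then have j: "j \<in> ?J" by (simp add: other_occurrences_def)
      let ?s = "s l j"
      have cx: "D #> (coset_rep c \<otimes> x) \<in> ?Q"
        using coset_rep[OF subD c] xG subgroup.subset[OF subD] by (simp add: rcosetsI)
      have defect: "translation_defect G D ?s c' \<in> H" if "c' \<in> ?Q" for c'
        using that l(1) j by (intro E_H) (force simp: E2_def)
      have "schreier_gen G D (D #> (?s \<otimes> coset_rep c)) x \<in> H"
        using l(2) j x by (intro E_H) (auto simp: E1_def B_def)
      then have "?s \<otimes> ?a \<otimes> inv ?s \<in> H"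
        unfolding conj_schreier_gen[OF normD c xG sG[OF l(1)]]
        using defect[OF c] defect[OF cx]
        by (intro subgroup.m_closed[OF subH] subgroup.m_inv_closed[OF subH])
      then show "inv (?t (pivot v)) \<otimes> ?t j \<otimes> ?a \<otimes> inv (inv (?t (pivot v)) \<otimes> ?t j) \<in> H"
        by (simp add: s_def offset_def)
    qed
    then show ?thesis using tG aG by simp
  qed
  have HD: "generate G (E1 \<union> E2) = D"
    using schreier_gens_generate[OF subD A(3,2) subH _ gens]
      generate_subgroup_incl[OF E_sub subD] by (simp add: H_def)
  have "card E1 \<le> (card S + card U) * card A"
  proof -
    have "card E1 \<le> card ((S \<union> U) \<times> A)"
      unfolding E1_def using finSU A(1) by (intro card_image_le) simp
    also have "\<dots> \<le> (card S + card U) * card A"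
      by (simp add: card_cartesian_product card_Un_le)
    finally show ?thesis .
  qed
  then have "real (card E1) \<le> real ((card S + card U) * card A)"
    by (simp only: of_nat_le_iff)
  also have "\<dots> = real (card S + card U) * real (card A)"
    by (rule of_nat_mult)
  also have "\<dots> \<le> (q + (1 - q ^ length w) ^ N) * real (card ?Q) * real (card A)"
    using S_card unfolding U_def by (intro mult_right_mono) simp_all
  finally have E1: "real (card E1) \<le> (q + (1 - q ^ length w) ^ N) * real (card ?Q) * real (card A)" .
  have "card E2 \<le> card (({..<N} \<times> ?J) \<times> ?Q)"
    unfolding E2_def using finQ finite_other_occurrences by (intro card_image_le) simp
  also have "\<dots> = N * card ?J * card ?Q"
    by (simp add: card_cartesian_product)
  also have "\<dots> \<le> N * length w * card ?Q"
    using card_other_occurrences[of v] v(4) by (intro mult_le_mono) auto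
  finally have "real (card E2) \<le> real (N * length w) * real (card ?Q)"
    by (metis of_nat_le_iff of_nat_mult)
  moreover have "real (card (E1 \<union> E2)) \<le> real (card E1) + real (card E2)"
    by (metis card_Un_le of_nat_add of_nat_le_iff)
  ultimately have "real (card (E1 \<union> E2))
      \<le> (real (card A) * (q + (1 - q ^ length w) ^ N) + real (N * length w)) * real (card ?Q)"
    using E1 by (simp add: algebra_simps)
  then show thesis by (rule that[OF D(1) fin E_sub HD])
qed

section \<open>Passage to subgroups and the vanishing of the gradient\<close>

lemma (in group) finitely_generated_finite_index:
  assumes "finitely_generated G" "finite_index_subgroup D G"
  shows "finitely_generated (G\<lparr>carrier := D\<rparr>)"
proof -
  have D: "subgroup D G" "finite (rcosets D)" using assms(2) by (auto simp: finite_index_subgroup_def)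
  obtain A where A: "finite A" "A \<subseteq> carrier G" "generate G A = carrier G"
    using assms(1) by (auto simp: finitely_generated_def)
  obtain E where "finite E" "E \<subseteq> D" "generate G E = D"
    by (rule schreier_bound[OF D A])
  then show ?thesis
    using generate_consistent[OF _ D(1), of E] unfolding finitely_generated_def by auto
qed

lemma (in group) residually_finite_subgroup:
  assumes "residually_finite G" "subgroup H G"
  shows "residually_finite (G\<lparr>carrier := H\<rparr>)"
  unfolding residually_finite_def
proof
  fix g assume g: "g \<in> carrier (G\<lparr>carrier := H\<rparr>) - {\<one>\<^bsub>G\<lparr>carrier := H\<rparr>\<^esub>}"
  then have "g \<in> carrier G - {\<one>}" using subgroup.mem_carrier[OF assms(2)] by auto
  then obtain N where N: "N \<lhd> G" "finite (rcosets N)" "g \<notin> N"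
    using assms(1) by (auto simp: residually_finite_def)
  note subN = normal_imp_subgroup[OF N(1)]
  have "rcosets\<^bsub>G\<lparr>carrier := H\<rparr>\<^esub> (N \<inter> H) \<subseteq> (\<lambda>c. c \<inter> H) ` (rcosets N)"
  proof
    fix c assume "c \<in> rcosets\<^bsub>G\<lparr>carrier := H\<rparr>\<^esub> (N \<inter> H)"
    then obtain x where x: "x \<in> H" "c = N \<inter> H #> x" by (auto simp: RCOSETS_def)
    have xG: "x \<in> carrier G" using x(1) subgroup.mem_carrier[OF assms(2)] by blast
    have "N \<inter> H #> x = (N #> x) \<inter> H"
    proof
      show "N \<inter> H #> x \<subseteq> (N #> x) \<inter> H"
        using x(1) subgroup.m_closed[OF assms(2)] by (auto simp: r_coset_def)
      show "(N #> x) \<inter> H \<subseteq> N \<inter> H #> x"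
      proof
        fix z assume z: "z \<in> (N #> x) \<inter> H"
        then have zG: "z \<in> carrier G" using subgroup.mem_carrier[OF assms(2)] by blast
        have "z \<otimes> inv x \<in> N" using z subgroup.rcos_module[OF subN is_group xG zG] by blast
        moreover have "z \<otimes> inv x \<in> H"
          using z x(1) subgroup.m_closed[OF assms(2)] subgroup.m_inv_closed[OF assms(2)] by blast
        moreover have "z = (z \<otimes> inv x) \<otimes> x" using zG xG by (simp add: group_word_simps)
        ultimately show "z \<in> N \<inter> H #> x" unfolding r_coset_def by blast
      qed
    qed
    then show "c \<in> (\<lambda>c. c \<inter> H) ` (rcosets N)"
      using x(2) xG subgroup.subset[OF subN] by (auto intro!: rcosetsI)
  qed
  then have "finite (rcosets\<^bsub>G\<lparr>carrier := H\<rparr>\<^esub> (N \<inter> H))"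
    using N(2) finite_subset by blast
  then show "\<exists>M. M \<lhd> G\<lparr>carrier := H\<rparr> \<and> finite (rcosets\<^bsub>G\<lparr>carrier := H\<rparr>\<^esub> M) \<and> g \<notin> M"
    using normal_Int_subgroup[OF assms(2) N(1)] N(3) by blast
qed

lemma (in group) group_law_subgroup:
  assumes "group_law G w" "subgroup H G"
  shows "group_law (G\<lparr>carrier := H\<rparr>) w"
proof -
  have "word_value (G\<lparr>carrier := H\<rparr>) g w = word_value G g w" if "\<And>i. g i \<in> H" for g w
    by (induction w) (use that m_inv_consistent[OF assms(2)] in auto)
  then show ?thesis
    using assms(1) subgroup.mem_carrier[OF assms(2)] by (simp add: group_law_def)
qed

text \<open>This yields \<open>|G : D| = |G : H| |H : D|\<close>, the finiteness of \<open>|G : D|\<close> included.\<close>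
lemma (in group) rcosets_tower:
  assumes "subgroup H G" "subgroup D (G\<lparr>carrier := H\<rparr>)"
  shows "bij_betw (\<lambda>(c, C). c #> coset_rep C) ((rcosets\<^bsub>G\<lparr>carrier := H\<rparr>\<^esub> D) \<times> (rcosets H)) (rcosets D)"
proof -
  let ?f = "\<lambda>(c, C). c #> coset_rep C"
  have D: "subgroup D G" using incl_subgroup[OF assms] .
  have DH: "D \<subseteq> H" using subgroup.subset[OF assms(2)] by simp
  have HG: "h \<in> carrier G" if "h \<in> H" for h using that subgroup.mem_carrier[OF assms(1)] by blast
  have inner: "rcosets\<^bsub>G\<lparr>carrier := H\<rparr>\<^esub> D = (\<lambda>h. D #> h) ` H" by (auto simp: RCOSETS_def)
  have f: "?f (D #> h, C) = D #> (h \<otimes> coset_rep C)" if "h \<in> H" "C \<in> rcosets H" for h C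
    using coset_mult_assoc[OF subgroup.subset[OF D] HG[OF that(1)] coset_rep(1)[OF assms(1) that(2)]]
    by simp
  have "inj_on ?f ((rcosets\<^bsub>G\<lparr>carrier := H\<rparr>\<^esub> D) \<times> (rcosets H))"
  proof (rule inj_onI)
    fix p p' assume "p \<in> (rcosets\<^bsub>G\<lparr>carrier := H\<rparr>\<^esub> D) \<times> (rcosets H)"
      "p' \<in> (rcosets\<^bsub>G\<lparr>carrier := H\<rparr>\<^esub> D) \<times> (rcosets H)" and eq: "?f p = ?f p'"
    then obtain h C h' C' where p: "p = (D #> h, C)" "h \<in> H" "C \<in> rcosets H"
      and p': "p' = (D #> h', C')" "h' \<in> H" "C' \<in> rcosets H"
      unfolding inner by blast
    let ?r = "coset_rep C" and ?r' = "coset_rep C'"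
    note r = coset_rep[OF assms(1) p(3)] and r' = coset_rep[OF assms(1) p'(3)]
    have h: "h \<in> carrier G" "h' \<in> carrier G" using HG p(2) p'(2) by auto
    have *: "h \<otimes> ?r \<otimes> inv (h' \<otimes> ?r') \<in> D"
      using eq f[OF p(2,3)] f[OF p'(2,3)] r_coset_eq_iff[OF D, of "h \<otimes> ?r" "h' \<otimes> ?r'"] h r(1) r'(1)
      by (simp add: p(1) p'(1))
    have "inv h \<otimes> (h \<otimes> ?r \<otimes> inv (h' \<otimes> ?r')) \<otimes> h' \<in> H"
      using * DH p(2) p'(2) by (meson assms(1) subgroup.m_closed subgroup.m_inv_closed subsetD)
    then have "?r \<otimes> inv ?r' \<in> H" using h r(1) r'(1) by (simp add: group_word_simps)
    then have C: "C = C'" using r_coset_eq_iff[OF assms(1) r(1) r'(1)] r(2) r'(2) by simp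
    then have "h \<otimes> inv h' \<in> D" using * h r(1) by (simp add: group_word_simps)
    then show "p = p'" using C r_coset_eq_iff[OF D h] p(1) p'(1) by simp
  qed
  moreover have "?f ` ((rcosets\<^bsub>G\<lparr>carrier := H\<rparr>\<^esub> D) \<times> (rcosets H)) = rcosets D"
  proof
    show "?f ` ((rcosets\<^bsub>G\<lparr>carrier := H\<rparr>\<^esub> D) \<times> (rcosets H)) \<subseteq> rcosets D"
    proof
      fix c assume "c \<in> ?f ` ((rcosets\<^bsub>G\<lparr>carrier := H\<rparr>\<^esub> D) \<times> (rcosets H))"
      then obtain h C where "h \<in> H" "C \<in> rcosets H" "c = ?f (D #> h, C)" unfolding inner by blast
      then show "c \<in> rcosets D"
        using f coset_rep(1)[OF assms(1)] HG subgroup.subset[OF D] by (simp add: rcosetsI)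
    qed
    show "rcosets D \<subseteq> ?f ` ((rcosets\<^bsub>G\<lparr>carrier := H\<rparr>\<^esub> D) \<times> (rcosets H))"
    proof
      fix c assume "c \<in> rcosets D"
      then obtain x where x: "x \<in> carrier G" "c = D #> x" by (auto simp: RCOSETS_def)
      let ?r = "coset_rep (H #> x)"
      note r = coset_rep_r_coset[OF assms(1) x(1)]
      have C: "H #> x \<in> rcosets H" using x(1) assms(1) by (simp add: rcosetsI subgroup.subset)
      have "c = ?f (D #> (x \<otimes> inv ?r), H #> x)"
        unfolding f[OF r(3) C] using x r(1) by (simp add: group_word_simps)
      then show "c \<in> ?f ` ((rcosets\<^bsub>G\<lparr>carrier := H\<rparr>\<^esub> D) \<times> (rcosets H))"
        using r(3) C unfolding inner by (intro image_eqI[of c ?f]) auto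
    qed
  qed
  ultimately show ?thesis by (simp add: bij_betw_def)
qed

lemma (in group) abelianization_hom:
  "group_hom G (abelianization G) (\<lambda>x. derived G (carrier G) #> x)"
  unfolding abelianization_def
  using normal.r_coset_hom_Mod[OF derived_self_is_normal]
    normal.factorgroup_is_group[OF derived_self_is_normal] is_group
  by (simp add: group_hom_def group_hom_axioms_def)

lemma (in group) generate_abelianization:
  assumes "E \<subseteq> carrier G" "generate G E = carrier G"
  shows "generate (abelianization G) ((\<lambda>x. derived G (carrier G) #> x) ` E) = carrier (abelianization G)"
  using group_hom.generate_img[OF abelianization_hom assms(1)] assms(2)
  by (simp add: abelianization_def carrier_FactGroup)

lemma (in group) min_generators_abelianization_le:
  assumes "finite E" "E \<subseteq> carrier G" "generate G E = carrier G"
  shows "min_generators (abelianization G) \<le> card E"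
proof -
  let ?h = "\<lambda>x. derived G (carrier G) #> x"
  have "?h ` E \<subseteq> carrier (abelianization G)"
    using assms(2) by (auto simp: abelianization_def carrier_FactGroup)
  then have "min_generators (abelianization G) \<le> card (?h ` E)"
    unfolding min_generators_def using generate_abelianization[OF assms(2,3)] assms(1)
    by (intro Least_le) blast
  then show ?thesis using card_image_le[OF assms(1), of ?h] by linarith
qed

text \<open>Finite generation ensures that the least number in the definition is attained; without it the
  value of \<open>min_generators\<close> carries no information.\<close>
lemma (in group) min_generators_abelianization_pos:
  assumes "finitely_generated G" "derived G (carrier G) \<noteq> carrier G"
  shows "min_generators (abelianization G) \<ge> 1"
proof (rule ccontr)
  let ?Q = "abelianization G" and ?K = "derived G (carrier G)"
  assume "\<not> min_generators ?Q \<ge> 1"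
  then have zero: "min_generators ?Q = 0" by simp
  interpret h: group_hom G ?Q "\<lambda>x. ?K #> x" by (rule abelianization_hom)
  obtain E where E: "finite E" "E \<subseteq> carrier G" "generate G E = carrier G"
    using assms(1) by (auto simp: finitely_generated_def)
  have "(\<lambda>x. ?K #> x) ` E \<subseteq> carrier ?Q" using E(2) h.hom_closed by blast
  then have "\<exists>n S. finite S \<and> card S = n \<and> S \<subseteq> carrier ?Q \<and> generate ?Q S = carrier ?Q"
    using generate_abelianization[OF E(2,3)] E(1) by blast
  then have "\<exists>S. finite S \<and> card S = min_generators ?Q \<and> S \<subseteq> carrier ?Q \<and> generate ?Q S = carrier ?Q"
    unfolding min_generators_def by (rule LeastI_ex)
  then have triv: "carrier ?Q = {\<one>\<^bsub>?Q\<^esub>}"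
    using zero h.H.generate_empty by auto
  have "x \<in> ?K" if x: "x \<in> carrier G" for x
  proof -
    have "?K #> x = ?K"
      using triv h.hom_closed[OF x] by (simp add: abelianization_def)
    then show ?thesis
      using rcos_self[OF x normal_imp_subgroup[OF derived_self_is_normal]] by simp
  qed
  then show False
    using assms(2) derived_in_carrier[of "carrier G"] by blast
qed

lemma (in group) large_finite_index_normal:
  assumes "residually_finite G" "infinite (carrier G)"
  obtains D where "finite_index_normal D G" "m \<le> card (rcosets D)"
proof -
  obtain T where T: "T \<subseteq> carrier G" "finite T" "card T = m"
    using infinite_arbitrarily_large[OF assms(2)] by metis
  let ?F = "(\<lambda>(x, y). x \<otimes> inv y) ` (T \<times> T) - {\<one>}"
  have "finite ?F" "?F \<subseteq> carrier G - {\<one>}" using T(1,2) by auto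
  then obtain D where D: "finite_index_normal D G" "D \<inter> ?F = {}"
    using residually_finite_separates[OF assms(1) _ _ finite_index_normal_carrier] by metis
  have sub: "subgroup D G" and fin: "finite (rcosets D)"
    using D(1) by (auto simp: finite_index_normal_def normal_imp_subgroup)
  have "inj_on (\<lambda>x. D #> x) T"
  proof (rule inj_onI)
    fix x y assume xy: "x \<in> T" "y \<in> T" "D #> x = D #> y"
    then have "x \<in> carrier G" "y \<in> carrier G" using T(1) by auto
    moreover from this have "x \<otimes> inv y \<in> D" using xy(3) r_coset_eq_iff[OF sub] by blast
    then have "x \<otimes> inv y = \<one>" using D(2) xy(1,2) by auto
    ultimately show "x = y" by (metis inv_equality inv_inv inv_closed)
  qed
  moreover have "(\<lambda>x. D #> x) ` T \<subseteq> rcosets D"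
    using T(1) rcosetsI[OF subgroup.subset[OF sub]] by blast
  ultimately have "m \<le> card (rcosets D)"
    using card_inj_on_le fin T(3) by blast
  with D(1) show thesis by (rule that)
qed

text \<open>The parameters are chosen in the order \<open>q\<close>, \<open>N\<close>, \<open>m\<close>: the first two make
  \<open>q + (1 - q\<^sup>\<ell>)\<^sup>N\<close> at most \<open>\<epsilon> / 2d\<close>, and an intermediate subgroup \<open>H\<close> of index at least \<open>m\<close>
  makes the cost \<open>N \<ell>\<close> of the defects at most \<open>\<epsilon> / 2\<close> times the index of \<open>H\<close>.\<close>
lemma (in group) exists_small_ab_gradient_term:
  assumes "finitely_generated G" "residually_finite G"
    and w: "group_law G w" "w \<noteq> []" "reduced_word w" and "0 < \<epsilon>"
  obtains D where "finite_index_subgroup D G" "ab_gradient_term G D \<le> \<epsilon>"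
proof (cases "finite (carrier G)")
  case True
  have triv: "subgroup {\<one>} G" by (rule triv_subgroup)
  have "finite (rcosets {\<one>})"
    using True finite_subset[OF rcosets_subset_PowG[OF triv]] by simp
  moreover have "min_generators (abelianization (G\<lparr>carrier := {\<one>}\<rparr>)) = 0"
  proof -
    interpret T: group "G\<lparr>carrier := {\<one>}\<rparr>" using subgroup_imp_group[OF triv] .
    show ?thesis using T.min_generators_abelianization_le[of "{}"] T.generate_empty by simp
  qed
  then have "ab_gradient_term G {\<one>} \<le> 0"
    by (simp add: ab_gradient_term_def)
  ultimately show thesis
    using triv assms(6) by (intro that[of "{\<one>}"]) (auto simp: finite_index_subgroup_def)
next
  case False
  obtain A where A: "finite A" "A \<subseteq> carrier G" "generate G A = carrier G"
    using assms(1) by (auto simp: finitely_generated_def)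
  \<comment> \<open>The summand 1 keeps \<open>d\<close> positive when \<open>A\<close> is empty.\<close>
  define d where "d = real (card A) + 1"
  have d: "d \<ge> 1" by (simp add: d_def)
  define q where "q = min (1 / 2) (\<epsilon> / (4 * d))"
  have q: "0 < q" "q < 1" "q \<le> \<epsilon> / (4 * d)" using assms(6) d by (auto simp: q_def)
  have "1 - q ^ length w < 1" using q by simp
  then obtain N where N: "(1 - q ^ length w) ^ N < \<epsilon> / (4 * d)"
    using real_arch_pow_inv[of "\<epsilon> / (4 * d)" "1 - q ^ length w"] assms(6) d by auto
  define \<beta> where "\<beta> = q + (1 - q ^ length w) ^ N"
  have \<beta>: "\<beta> \<le> \<epsilon> / (2 * d)" using q(3) N d by (simp add: \<beta>_def field_simps)
  have \<beta>0: "0 \<le> \<beta>" using q by (simp add: \<beta>_def power_le_one)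
  obtain m :: nat where m: "2 * real (N * length w) / \<epsilon> \<le> real m"
    using real_arch_simple by blast
  obtain H where H: "finite_index_normal H G" "m \<le> card (rcosets H)"
    using large_finite_index_normal[OF assms(2) False] by blast
  have subH: "subgroup H G" and finH: "finite (rcosets H)"
    using H(1) by (auto simp: finite_index_normal_def normal_imp_subgroup)
  let ?H = "G\<lparr>carrier := H\<rparr>"
  let ?M = "real (card (rcosets H))"
  obtain A' where A': "finite A'" "A' \<subseteq> H" "generate G A' = H" "card A' \<le> card A * card (rcosets H)"
    by (rule schreier_bound[OF subH finH A])
  interpret H: group ?H using subgroup_imp_group[OF subH] .
  have genA': "generate ?H A' = carrier ?H"
    using generate_consistent[OF A'(2) subH] A'(3) by simp
  obtain D E where D: "finite_index_normal D ?H" and E: "finite E" "E \<subseteq> D" "generate ?H E = D"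
    and card_E: "real (card E) \<le> (real (card A') * \<beta> + real (N * length w)) * real (card (rcosets\<^bsub>?H\<^esub> D))"
    using H.finite_index_subgroup_few_generators[OF residually_finite_subgroup[OF assms(2) subH]
        group_law_subgroup[OF w(1) subH] w(2,3) A'(1) _ genA' q(1,2), of N] A'(2)
    unfolding \<beta>_def by auto
  let ?n = "real (card (rcosets\<^bsub>?H\<^esub> D))"
  have subDH: "subgroup D ?H" and finD: "finite (rcosets\<^bsub>?H\<^esub> D)"
    using D by (auto simp: finite_index_normal_def normal_imp_subgroup)
  have subD: "subgroup D G" using incl_subgroup[OF subH subDH] .
  have DH: "D \<subseteq> H" using subgroup.subset[OF subDH] by simp
  have finite_rcosets: "finite (rcosets D)"
    using bij_betw_finite[OF rcosets_tower[OF subH subDH]] finD finH by simp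
  have index: "real (subgroup_index G D) = ?n * ?M"
    using bij_betw_same_card[OF rcosets_tower[OF subH subDH]]
    by (simp add: subgroup_index_def card_cartesian_product flip: of_nat_mult)
  interpret D: group "G\<lparr>carrier := D\<rparr>" using subgroup_imp_group[OF subD] .
  have "generate G E = D"
    using generate_consistent[of E H] E(2,3) DH subH by simp
  then have "real (min_generators (abelianization (G\<lparr>carrier := D\<rparr>))) \<le> real (card E)"
    using D.min_generators_abelianization_le[OF E(1)] E(2) generate_consistent[OF E(2) subD] by simp
  also have "\<dots> \<le> (real (card A') * \<beta> + real (N * length w)) * ?n" by (rule card_E)
  also have "\<dots> \<le> (\<epsilon> * ?M) * ?n"
  proof (rule mult_right_mono)
    have "real (card A') \<le> d * ?M"
    proof -
      have "real (card A') \<le> real (card A) * ?M" using A'(4) by (simp flip: of_nat_mult)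
      also have "\<dots> \<le> d * ?M" by (simp add: d_def mult_right_mono)
      finally show ?thesis .
    qed
    then have "real (card A') * \<beta> \<le> (d * ?M) * (\<epsilon> / (2 * d))"
      using \<beta> \<beta>0 d by (intro mult_mono) auto
    also have "\<dots> = \<epsilon> / 2 * ?M" using d by (simp add: field_simps)
    finally have 1: "real (card A') * \<beta> \<le> \<epsilon> / 2 * ?M" .
    have "2 * real (N * length w) / \<epsilon> \<le> ?M" using m H(2) by linarith
    then have "real (N * length w) \<le> \<epsilon> / 2 * ?M" using assms(6) by (simp add: field_simps)
    with 1 show "real (card A') * \<beta> + real (N * length w) \<le> \<epsilon> * ?M" by simp
  qed simp
  finally have "real (min_generators (abelianization (G\<lparr>carrier := D\<rparr>))) - 1
      \<le> \<epsilon> * real (subgroup_index G D)"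
    unfolding index by (simp add: mult_ac)
  then have "ab_gradient_term G D \<le> \<epsilon>"
    using assms(6) unfolding ab_gradient_term_def
    by (cases "subgroup_index G D = 0") (simp_all add: pos_divide_le_eq)
  then show thesis
    using subD finite_rcosets by (intro that[of D]) (simp_all add: finite_index_subgroup_def)
qed

theorem corollary2:
  fixes G :: "('a, 'b) monoid_scheme"
  assumes "group G"
    and "finitely_generated G"
    and "residually_finite G"
    and "satisfies_group_law G"
  shows "Inf {max 0 (ab_gradient_term G D) | D. finite_index_subgroup D G} = 0
    \<and> ((\<forall>D. finite_index_subgroup D G \<longrightarrow> derived G D \<noteq> D) \<longrightarrow>
         Inf {ab_gradient_term G D | D. finite_index_subgroup D G} = 0)"
proof -
  interpret group G by fact
  obtain k w where "w \<in> free_group_elements k" "w \<noteq> []"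
    and "\<And>g. (\<forall>i<k. g i \<in> carrier G) \<Longrightarrow> word_value G g w = \<one>\<^bsub>G\<^esub>"
    using assms(4) unfolding satisfies_group_law_def by metis
  then have w: "group_law G w" "w \<noteq> []" "reduced_word w"
    by (auto simp: group_law_def free_group_elements_def)
  have Inf_zero: "Inf {max 0 (ab_gradient_term G D) | D. finite_index_subgroup D G} = 0"
  proof (rule cInf_eq)
    fix y assume y: "\<And>x. x \<in> {max 0 (ab_gradient_term G D) | D. finite_index_subgroup D G} \<Longrightarrow> y \<le> x"
    show "y \<le> 0"
    proof (rule field_le_epsilon)
      fix \<epsilon> :: real assume "0 < \<epsilon>"
      then obtain D where "finite_index_subgroup D G" "ab_gradient_term G D \<le> \<epsilon>"
        using exists_small_ab_gradient_term[OF assms(2,3) w] by metis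
      then show "y \<le> 0 + \<epsilon>" using y[of "max 0 (ab_gradient_term G D)"] \<open>0 < \<epsilon>\<close> by fastforce
    qed
  qed auto
  moreover have "{ab_gradient_term G D | D. finite_index_subgroup D G}
      = {max 0 (ab_gradient_term G D) | D. finite_index_subgroup D G}"
    if imperfect: "\<forall>D. finite_index_subgroup D G \<longrightarrow> derived G D \<noteq> D"
  proof -
    have "max 0 (ab_gradient_term G D) = ab_gradient_term G D" if D: "finite_index_subgroup D G" for D
    proof -
      have sub: "subgroup D G" using D by (simp add: finite_index_subgroup_def)
      interpret D: group "G\<lparr>carrier := D\<rparr>" using subgroup_imp_group[OF sub] .
      have "min_generators (abelianization (G\<lparr>carrier := D\<rparr>)) \<ge> 1"
        using D.min_generators_abelianization_pos[OF finitely_generated_finite_index[OF assms(2) D]]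
          derived_consistent[OF order_refl sub] imperfect D by simp
      then show ?thesis by (simp add: ab_gradient_term_def)
    qed
    then show ?thesis by force
  qed
  ultimately show ?thesis by simp
qed

end
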